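(* Let $G$ and $H$ be isoclinic finite groups. If there exists a multiply induced irreducible character of $G$, then there exists a multiply induced irreducible character of $H$.
   Context: All characters are complex characters of finite groups. A character $\chi$ of a finite group $G$ is called multiply induced if there are distinct proper subgroups $U_1$ and $U_2$ of $G$ and characters $\psi_1$ of $U_1$ and $\psi_2$ of $U_2$ such that $\chi = \psi_1^G = \psi_2^G$ (induced characters). Finite groups $G$ and $H$ are isoclinic if there exist isomorphisms $\eta : G/Z(G) \to H/Z(H)$ and $\xi : G' \to H'$ (where $Z(\cdot)$ is the center and $'$ denotes the commutator subgroup) compatible with commutator maps, i.e. whenever $\eta(g_i Z(G)) = h_i Z(H)$ for $i=1,2$ with $g_i \in G$, $h_i \in H$, one has $\xi([g_1,g_2]) = [h_1,h_2]$. *)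

theory Defs
  imports "HOL-Algebra.Algebra" "Jordan_Normal_Form.VS_Connect"
begin

definition GL :: "nat \<Rightarrow> complex mat monoid" where
  "GL n = units_of (ring_mat TYPE(complex) n ())"

definition representation ::
  "('a, 'm) monoid_scheme \<Rightarrow> nat \<Rightarrow> ('a \<Rightarrow> complex mat) \<Rightarrow> bool" where
  "representation G n \<rho> \<longleftrightarrow> 0 < n \<and> \<rho> \<in> hom G (GL n)"

definition irreducible_representation ::
  "('a, 'm) monoid_scheme \<Rightarrow> nat \<Rightarrow> ('a \<Rightarrow> complex mat) \<Rightarrow> bool" where
  "irreducible_representation G n \<rho> \<longleftrightarrow> representation G n \<rho> \<and>
     (\<forall>W. VectorSpace.subspace class_ring W (module_vec TYPE(complex) n) \<and>
          (\<forall>g\<in>carrier G. \<forall>w\<in>W. \<rho> g *\<^sub>v w \<in> W)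
        \<longrightarrow> W = {0\<^sub>v n} \<or> W = carrier_vec n)"

definition mat_trace :: "'a::comm_monoid_add mat \<Rightarrow> 'a" where
  "mat_trace A = (\<Sum>i<dim_row A. A $$ (i, i))"

text \<open>
  Functions on a group \<open>G\<close> are taken to be extensional (\<open>undefined\<close> outside
  \<open>carrier G\<close>), so that equality of characters is equality on \<open>carrier G\<close>.
\<close>

definition char_of ::
  "('a, 'm) monoid_scheme \<Rightarrow> ('a \<Rightarrow> complex mat) \<Rightarrow> 'a \<Rightarrow> complex" where
  "char_of G \<rho> = (\<lambda>g\<in>carrier G. mat_trace (\<rho> g))"

definition is_character :: "('a, 'm) monoid_scheme \<Rightarrow> ('a \<Rightarrow> complex) \<Rightarrow> bool" where
  "is_character G \<chi> \<longleftrightarrow> (\<exists>n \<rho>. representation G n \<rho> \<and> \<chi> = char_of G \<rho>)"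

definition irreducible_character :: "('a, 'm) monoid_scheme \<Rightarrow> ('a \<Rightarrow> complex) \<Rightarrow> bool" where
  "irreducible_character G \<chi> \<longleftrightarrow>
     (\<exists>n \<rho>. irreducible_representation G n \<rho> \<and> \<chi> = char_of G \<rho>)"

text \<open>
  The usual formula for the induced class function: \<open>\<psi>\<close> is extended by zero from the
  subgroup \<open>U\<close> to the finite group \<open>G\<close> and averaged over conjugation by \<open>G\<close>.
\<close>

definition induced ::
  "('a, 'm) monoid_scheme \<Rightarrow> 'a set \<Rightarrow> ('a \<Rightarrow> complex) \<Rightarrow> 'a \<Rightarrow> complex" where
  "induced G U \<psi> = (\<lambda>g\<in>carrier G. (1 / of_nat (card U)) *
     (\<Sum>x\<in>carrier G. let y = x \<otimes>\<^bsub>G\<^esub> g \<otimes>\<^bsub>G\<^esub> inv\<^bsub>G\<^esub> x in if y \<in> U then \<psi> y else 0))"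

definition proper_subgroup :: "'a set \<Rightarrow> ('a, 'm) monoid_scheme \<Rightarrow> bool" where
  "proper_subgroup U G \<longleftrightarrow> subgroup U G \<and> U \<noteq> carrier G"

definition multiply_induced :: "('a, 'm) monoid_scheme \<Rightarrow> ('a \<Rightarrow> complex) \<Rightarrow> bool" where
  "multiply_induced G \<chi> \<longleftrightarrow> is_character G \<chi> \<and>
     (\<exists>U\<^sub>1 U\<^sub>2 \<psi>\<^sub>1 \<psi>\<^sub>2.
        proper_subgroup U\<^sub>1 G \<and> proper_subgroup U\<^sub>2 G \<and> U\<^sub>1 \<noteq> U\<^sub>2 \<and>
        is_character (G\<lparr>carrier := U\<^sub>1\<rparr>) \<psi>\<^sub>1 \<and> is_character (G\<lparr>carrier := U\<^sub>2\<rparr>) \<psi>\<^sub>2 \<and>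
        \<chi> = induced G U\<^sub>1 \<psi>\<^sub>1 \<and> \<chi> = induced G U\<^sub>2 \<psi>\<^sub>2)"


definition center :: "('a, 'm) monoid_scheme \<Rightarrow> 'a set" where
  "center G = {z \<in> carrier G. \<forall>g\<in>carrier G. z \<otimes>\<^bsub>G\<^esub> g = g \<otimes>\<^bsub>G\<^esub> z}"

text \<open>
  The convention for commutators is that of \<^const>\<open>derived\<close>. With
  \<open>[x, y] = x\<^sup>-\<^sup>1 y\<^sup>-\<^sup>1 x y\<close> one gets the same isoclinism relation (with the same pairs of
  isomorphisms), since a pair of cosets may be replaced by the pair of their inverses.
\<close>

definition commutator :: "('a, 'm) monoid_scheme \<Rightarrow> 'a \<Rightarrow> 'a \<Rightarrow> 'a" where
  "commutator G x y = x \<otimes>\<^bsub>G\<^esub> y \<otimes>\<^bsub>G\<^esub> inv\<^bsub>G\<^esub> x \<otimes>\<^bsub>G\<^esub> inv\<^bsub>G\<^esub> y"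

definition commutator_subgroup :: "('a, 'm) monoid_scheme \<Rightarrow> ('a, 'm) monoid_scheme" where
  "commutator_subgroup G = G\<lparr>carrier := derived G (carrier G)\<rparr>"

definition isoclinic :: "('a, 'm) monoid_scheme \<Rightarrow> ('b, 'n) monoid_scheme \<Rightarrow> bool" where
  "isoclinic G H \<longleftrightarrow>
     (\<exists>\<eta> \<xi>. \<eta> \<in> iso (G Mod center G) (H Mod center H) \<and>
        \<xi> \<in> iso (commutator_subgroup G) (commutator_subgroup H) \<and>
        (\<forall>g\<^sub>1\<in>carrier G. \<forall>g\<^sub>2\<in>carrier G. \<forall>h\<^sub>1\<in>carrier H. \<forall>h\<^sub>2\<in>carrier H.
           \<eta> (center G #>\<^bsub>G\<^esub> g\<^sub>1) = center H #>\<^bsub>H\<^esub> h\<^sub>1 \<and>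
           \<eta> (center G #>\<^bsub>G\<^esub> g\<^sub>2) = center H #>\<^bsub>H\<^esub> h\<^sub>2 \<longrightarrow>
           \<xi> (commutator G g\<^sub>1 g\<^sub>2) = commutator H h\<^sub>1 h\<^sub>2))"

end

theory Submission
  imports Defs "Jordan_Normal_Form.Spectral_Radius"
begin

text \<open>
  Let \<open>R\<close> be the fibre product of \<open>G\<close> and \<open>H\<close> over the common quotient by the centers, and let
  \<open>\<rho>\<close> be an irreducible representation of \<open>G\<close> with central character \<open>\<omega>\<close>. The commutator subgroup
  of \<open>R\<close> is the graph of the isomorphism \<open>G' \<rightarrow> H'\<close>, so it meets \<open>Z(G) \<times> 1\<close> trivially, and hence
  \<open>\<omega>\<^sup>-\<^sup>1\<close> on \<open>Z(G) \<times> 1\<close> extends to a linear character \<open>\<mu>\<close> of \<open>R\<close>. Then \<open>\<mu>(x, y) \<rho>(x)\<close> depends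
  only on \<open>y\<close> and is an irreducible representation of \<open>H\<close>. If the character of \<open>\<rho>\<close> is induced from
  a representation \<open>\<sigma>\<close> of \<open>U\<close>, evaluating it on \<open>Z(G)\<close> shows that \<open>Z(G) \<subseteq> U\<close> and that \<open>\<sigma>\<close> is
  the scalar \<open>\<omega>\<close> on \<open>Z(G)\<close>. So \<open>\<sigma>\<close> can be carried over to the subgroup of \<open>H\<close> corresponding to
  \<open>U\<close> in the same way, and this commutes with induction.
\<close>

section \<open>Extension of linear characters\<close>

lemma complex_nth_root:
  fixes z :: complex
  assumes "0 < n"
  obtains c where "c ^ n = z"
proof
  have "rcis (root n (cmod z)) (Arg z / n) ^ n = rcis (root n (cmod z) ^ n) (n * (Arg z / n))"
    by (simp add: DeMoivre2)
  also have "\<dots> = z" using assms by (simp add: rcis_cmod_Arg)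
  finally show "rcis (root n (cmod z)) (Arg z / n) ^ n = z" .
qed

lemma (in group) mult_commutator:
  assumes "x \<in> carrier G" "y \<in> carrier G"
  shows "x \<otimes> y = commutator G x y \<otimes> (y \<otimes> x)"
proof -
  have "inv y \<otimes> (y \<otimes> x) = x" "inv x \<otimes> x = \<one>"
    using assms by (simp_all flip: m_assoc)
  then show ?thesis
    using assms by (simp add: commutator_def m_assoc)
qed

text \<open>Adjoin \<open>x\<close> to \<open>A\<close>: the new subgroup consists of the products
  \<open>a \<otimes> x [^] i\<close>, on which the extension is \<open>f a * c powi i\<close> for a
  suitable root \<open>c\<close>. Since all commutators lie in \<open>A\<close> and \<open>f\<close>
  is 1 on them, reordering factors does not affect the values, so non-commutativity does no
  harm.\<close>

lemma (in group) extend_linear_character_step: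
  fixes f :: "'a \<Rightarrow> complex"
  assumes fin: "finite (carrier G)" and A: "subgroup A G"
    and comm: "\<And>x y. x \<in> carrier G \<Longrightarrow> y \<in> carrier G \<Longrightarrow> commutator G x y \<in> A"
      "\<And>x y. x \<in> carrier G \<Longrightarrow> y \<in> carrier G \<Longrightarrow> f (commutator G x y) = 1"
    and f_mult: "\<And>a b. a \<in> A \<Longrightarrow> b \<in> A \<Longrightarrow> f (a \<otimes> b) = f a * f b"
    and x: "x \<in> carrier G" "x \<notin> A"
  obtains B g where "subgroup B G" "A \<subset> B" "\<And>a. a \<in> A \<Longrightarrow> g a = f a"
    "\<And>a b. a \<in> B \<Longrightarrow> b \<in> B \<Longrightarrow> g (a \<otimes> b) = (g a * g b :: complex)"
proof -
  interpret A: subgroup A G by (rule A)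
  \<comment> \<open>\<open>\<one>\<close> is the commutator of itself with itself. Multiplicativity
    alone would leave the zero function possible.\<close>
  have f1: "f \<one> = 1"
    using comm(2)[of \<one> \<one>] by (simp add: commutator_def)
  have f_inv: "f a * f (inv a) = 1" if "a \<in> A" for a
    using f_mult[of a "inv a"] f1 that by simp
  have nz: "f a \<noteq> 0" if "a \<in> A" for a
    using f_inv[OF that] by auto
  have npow: "a [^] (q::nat) \<in> A \<and> f (a [^] q) = f a ^ q" if "a \<in> A" for a q
  proof (induction q)
    case (Suc q)
    then show ?case
      using f_mult[of "a [^] q" a] that by simp
  qed (simp add: f1)
  have ipow: "a [^] (q::int) \<in> A \<and> f (a [^] q) = f a powi q" if a: "a \<in> A" for a q
  proof (cases q rule: int_cases2)
    case (nonneg k)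
    then show ?thesis
      using npow[OF a, of k] by (simp add: int_pow_int)
  next
    case (nonpos k)
    have k: "a [^] k \<in> A" "f (a [^] k) = f a ^ k"
      using npow[OF a] by auto
    then have "f (inv (a [^] k)) = inverse (f a ^ k)"
      using f_inv[of "a [^] k"] by (metis inverse_unique)
    then show ?thesis
      using k a by (simp add: nonpos int_pow_neg_int power_int_minus)
  qed
  define n where "n = (LEAST n::nat. 0 < n \<and> x [^] n \<in> A)"
  \<comment> \<open>The group order is a positive exponent that takes \<open>x\<close> into
    \<open>A\<close>, so the least such exponent \<open>n\<close> exists.\<close>
  have "0 < Coset.order G \<and> x [^] Coset.order G \<in> A"
    using fin x(1) pow_order_eq_1 by (simp add: order_gt_0_iff_finite)
  then have n: "0 < n \<and> x [^] n \<in> A"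
    unfolding n_def by (rule LeastI)
  have n_least: "\<not> (0 < k \<and> x [^] k \<in> A)" if "k < n" for k
    using that unfolding n_def by (rule not_less_Least)
  obtain c where c: "c ^ n = f (x [^] n)"
    using complex_nth_root n by blast
  have c_nz: "c \<noteq> 0"
    using c nz n by (metis power_0_left not_less_zero)
  \<comment> \<open>On the powers of \<open>x\<close> that already lie in \<open>A\<close>, the
    prescribed values agree with \<open>f\<close>. Division of \<open>i\<close> by \<open>n\<close>
    leaves a remainder \<open>r < n\<close> with \<open>x [^] r\<close> in \<open>A\<close>, and
    minimality of \<open>n\<close> forces \<open>r = 0\<close>.\<close>
  have powA: "f (x [^] i) = c powi i" if "x [^] i \<in> A" for i :: int
  proof -
    define q r where "q = i div int n" and "r = nat (i mod int n)"
    have i: "i = int r + int n * q" "r < n"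
      using n unfolding q_def r_def by (auto simp: nat_less_iff)
    have q: "(x [^] n) [^] q \<in> A" "f ((x [^] n) [^] q) = c powi (int n * q)"
      using ipow[of "x [^] n" q] n c by (auto simp: power_int_mult)
    have xi: "x [^] i = x [^] r \<otimes> (x [^] n) [^] q"
      using x(1) by (simp add: i(1) int_pow_mult flip: int_pow_int int_pow_pow)
    then have "x [^] r = x [^] i \<otimes> inv ((x [^] n) [^] q)"
      using x(1) by (simp add: m_assoc)
    then have "x [^] r \<in> A"
      using that q(1) by simp
    then have "r = 0"
      using n_least[OF i(2)] by simp
    then show ?thesis
      using xi i(1) q x(1) by simp
  qed
  define B where "B = {a \<otimes> x [^] i | a i. a \<in> A \<and> i \<in> (UNIV :: int set)}"
  \<comment> \<open>The decomposition \<open>y = a \<otimes> x [^] i\<close> is not unique, so a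
    value is chosen. The fact \<open>g\<close> below shows that all decompositions give the same
    value: two of them differ by a power of \<open>x\<close> in \<open>A\<close>, which
    \<open>powA\<close> handles.\<close>
  define g where "g y = (SOME v. \<exists>a\<in>A. \<exists>i::int. y = a \<otimes> x [^] i \<and> v = f a * c powi i)" for y
  have g: "g (a \<otimes> x [^] i) = f a * c powi i" if a: "a \<in> A" for a and i :: int
  proof -
    have "\<exists>v. \<exists>b\<in>A. \<exists>j::int. a \<otimes> x [^] i = b \<otimes> x [^] j \<and> v = f b * c powi j"
      using a by blast
    then have "\<exists>b\<in>A. \<exists>j::int. a \<otimes> x [^] i = b \<otimes> x [^] j \<and> g (a \<otimes> x [^] i) = f b * c powi j"
      unfolding g_def by (rule someI_ex)
    then obtain b j where b: "b \<in> A" "a \<otimes> x [^] i = b \<otimes> x [^] (j::int)"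
        "g (a \<otimes> x [^] i) = f b * c powi j"
      by blast
    have "x [^] (i - j) = inv a \<otimes> (a \<otimes> x [^] i) \<otimes> inv (x [^] j)"
      using a x(1) by (simp add: int_pow_diff flip: m_assoc)
    also have "\<dots> = inv a \<otimes> b"
      using a b(1) x(1) by (simp add: b(2) m_assoc)
    finally have "x [^] (i - j) = inv a \<otimes> b" .
    then have "f (inv a) * f b = c powi (i - j)"
      using powA[of "i - j"] a b(1) by (simp add: f_mult)
    then have "f a * f (inv a) * f b * c powi j = f a * (c powi (i - j) * c powi j)"
      by simp
    then show ?thesis
      using b(3) f_inv[OF a] c_nz by (simp flip: power_int_add)
  qed
  \<comment> \<open>Moving \<open>x [^] i\<close> past \<open>b\<close> costs a commutator, which
    lies in \<open>A\<close> and has \<open>f\<close>-value 1.\<close>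
  have prod: "(a \<otimes> x [^] i) \<otimes> (b \<otimes> x [^] j)
      = a \<otimes> commutator G (x [^] i) b \<otimes> b \<otimes> x [^] (i + j)"
    if "a \<in> A" "b \<in> A" for a b and i j :: int
  proof -
    have "(a \<otimes> x [^] i) \<otimes> (b \<otimes> x [^] j) = a \<otimes> (x [^] i \<otimes> b) \<otimes> x [^] j"
      using that x(1) by (simp add: m_assoc)
    also have "x [^] i \<otimes> b = commutator G (x [^] i) b \<otimes> (b \<otimes> x [^] i)"
      using that x(1) by (intro mult_commutator) auto
    finally show ?thesis
      using that x(1) comm(1)[of "x [^] i" b] by (simp add: m_assoc int_pow_mult)
  qed
  have BI: "a \<otimes> x [^] i \<in> B" if "a \<in> A" for a and i :: int
    using that unfolding B_def by blast
  have B_mult: "a \<otimes> b \<in> B \<and> g (a \<otimes> b) = g a * g b" if aB: "a \<in> B" "b \<in> B" for a b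
  proof -
    obtain a' i b' j where ab: "a' \<in> A" "b' \<in> A" "a = a' \<otimes> x [^] (i::int)" "b = b' \<otimes> x [^] (j::int)"
      using aB unfolding B_def by blast
    have k: "commutator G (x [^] i) b' \<in> A" "f (commutator G (x [^] i) b') = 1"
      using comm ab x(1) by auto
    have "a' \<otimes> commutator G (x [^] i) b' \<otimes> b' \<in> A"
      using k ab by simp
    then show ?thesis
      using k ab c_nz g prod[OF ab(1,2), of i j] BI
      by (simp add: f_mult power_int_add)
  qed
  have sub: "A \<subseteq> B"
    using BI[of _ 0] by auto
  have "x \<in> B"
    using BI[of \<one> 1] x(1) by simp
  then have "A \<subset> B"
    using sub x(2) by blast
  moreover have "subgroup B G"
  proof (rule subgroupI)
    show "B \<subseteq> carrier G" unfolding B_def using x(1) by auto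
    show "B \<noteq> {}" using sub A.one_closed by blast
    show "a \<otimes> b \<in> B" if "a \<in> B" "b \<in> B" for a b using B_mult that by blast
    fix y assume "y \<in> B"
    then obtain a i where y: "a \<in> A" "y = a \<otimes> x [^] (i::int)"
      unfolding B_def by blast
    \<comment> \<open>The inverse comes with the power of \<open>x\<close> on the wrong side. As a
      product of two elements of \<open>B\<close> it is covered by \<open>B_mult\<close>.\<close>
    then have "inv y = (\<one> \<otimes> x [^] (-i)) \<otimes> (inv a \<otimes> x [^] (0::int))"
      using x(1) by (simp add: inv_mult_group int_pow_neg)
    moreover have "\<one> \<otimes> x [^] (-i) \<in> B" "inv a \<otimes> x [^] (0::int) \<in> B"
      using BI[of \<one> "- i"] BI[of "inv a" 0] y by simp_all
    ultimately show "inv y \<in> B"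
      using B_mult by simp
  qed
  moreover have "g a = f a" if "a \<in> A" for a
    using g[OF that, of 0] that by simp
  ultimately show thesis
    using that B_mult by blast
qed

text \<open>Elements are adjoined one at a time, by induction on the size of the complement of
  \<open>A\<close>. The hypotheses on commutators persist because each new function agrees with the
  old one on the old subgroup.\<close>

lemma (in group) extend_linear_character:
  fixes f :: "'a \<Rightarrow> complex"
  assumes fin: "finite (carrier G)" and "subgroup A G"
    and "\<And>x y. x \<in> carrier G \<Longrightarrow> y \<in> carrier G \<Longrightarrow> commutator G x y \<in> A"
    and "\<And>x y. x \<in> carrier G \<Longrightarrow> y \<in> carrier G \<Longrightarrow> f (commutator G x y) = 1"
    and "\<And>a b. a \<in> A \<Longrightarrow> b \<in> A \<Longrightarrow> f (a \<otimes> b) = f a * f b"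
  shows "\<exists>\<mu> :: 'a \<Rightarrow> complex. (\<forall>x\<in>carrier G. \<forall>y\<in>carrier G. \<mu> (x \<otimes> y) = \<mu> x * \<mu> y) \<and> (\<forall>a\<in>A. \<mu> a = f a)"
  using assms(2-)
proof (induction "card (carrier G - A)" arbitrary: A f rule: less_induct)
  case less
  show ?case
  proof (cases "carrier G \<subseteq> A")
    case True
    then show ?thesis using less.prems(4) by blast
  next
    case False
    then obtain x where x: "x \<in> carrier G" "x \<notin> A" by blast
    obtain B g where B: "subgroup B G" "A \<subset> B" "\<And>a. a \<in> A \<Longrightarrow> g a = f a"
        "\<And>a b. a \<in> B \<Longrightarrow> b \<in> B \<Longrightarrow> g (a \<otimes> b) = (g a * g b :: complex)"
      using extend_linear_character_step[OF fin less.prems x] by metis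
    have "carrier G - B \<subset> carrier G - A"
      using B(2) subgroup.subset[OF B(1)] by blast
    then have "card (carrier G - B) < card (carrier G - A)"
      using fin by (intro psubset_card_mono) auto
    then obtain \<mu> :: "'a \<Rightarrow> complex"
      where \<mu>: "\<forall>x\<in>carrier G. \<forall>y\<in>carrier G. \<mu> (x \<otimes> y) = \<mu> x * \<mu> y" "\<forall>a\<in>B. \<mu> a = g a"
    proof (atomize_elim, rule less.hyps)
      show "commutator G x y \<in> B" "g (commutator G x y) = 1"
        if "x \<in> carrier G" "y \<in> carrier G" for x y
        using less.prems(2,3)[OF that] B(2,3) by auto
    qed (use B(1,4) in auto)
    have "\<mu> a = f a" if "a \<in> A" for a
      using \<mu>(2) B(2,3) that by auto
    then show ?thesis
      using \<mu>(1) by blast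
  qed
qed

section \<open>Matrix representations\<close>

lemma subspace_vec_iff:
  "VectorSpace.subspace class_ring W (module_vec TYPE('a::field) n) \<longleftrightarrow>
     W \<subseteq> carrier_vec n \<and> 0\<^sub>v n \<in> W \<and> (\<forall>v\<in>W. \<forall>w\<in>W. v + w \<in> W) \<and> (\<forall>a. \<forall>v\<in>W. a \<cdot>\<^sub>v v \<in> W)"
  using vec_vs[where 'a='a and n=n] vec_module[where 'a='a and n=n]
  by (auto simp: VectorSpace.subspace_def submodule_def module_vec_simps class_ring_simps)

text \<open>Invertibility of \<open>\<rho> x\<close> is encoded by the remaining conditions:
  \<open>\<rho> (inv x)\<close> is a two-sided inverse once \<open>\<rho> \<one>\<close> is the
  identity matrix.\<close>

lemma (in group) representation_iff:
  "representation G n \<rho> \<longleftrightarrow> 0 < n \<and> (\<forall>x\<in>carrier G. \<rho> x \<in> carrier_mat n n) \<and> \<rho> \<one> = 1\<^sub>m n \<and>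
     (\<forall>x\<in>carrier G. \<forall>y\<in>carrier G. \<rho> (x \<otimes> y) = \<rho> x * \<rho> y)"
proof -
  interpret M: ring "ring_mat TYPE(complex) n ()" by (rule ring_mat)
  have GL: "group (GL n)"
    unfolding GL_def by (rule M.units_group)
  have GL_simps: "x \<in> carrier (GL n) \<longleftrightarrow>
      x \<in> carrier_mat n n \<and> (\<exists>y\<in>carrier_mat n n. y * x = 1\<^sub>m n \<and> x * y = 1\<^sub>m n)"
    "x \<otimes>\<^bsub>GL n\<^esub> y = x * y" "\<one>\<^bsub>GL n\<^esub> = 1\<^sub>m n" for x y
    unfolding GL_def by (auto simp: units_of_def Units_def ring_mat_def)
  show ?thesis
  proof
    assume r: "representation G n \<rho>"
    then have "\<rho> \<one> = \<one>\<^bsub>GL n\<^esub>"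
      using hom_one[OF _ is_group GL] by (simp add: representation_def)
    then show "0 < n \<and> (\<forall>x\<in>carrier G. \<rho> x \<in> carrier_mat n n) \<and> \<rho> \<one> = 1\<^sub>m n \<and>
        (\<forall>x\<in>carrier G. \<forall>y\<in>carrier G. \<rho> (x \<otimes> y) = \<rho> x * \<rho> y)"
      using r by (auto simp: representation_def hom_def GL_simps)
  next
    assume r: "0 < n \<and> (\<forall>x\<in>carrier G. \<rho> x \<in> carrier_mat n n) \<and> \<rho> \<one> = 1\<^sub>m n \<and>
        (\<forall>x\<in>carrier G. \<forall>y\<in>carrier G. \<rho> (x \<otimes> y) = \<rho> x * \<rho> y)"
    have "\<rho> x \<in> carrier (GL n)" if x: "x \<in> carrier G" for x
    proof -
      have "\<rho> (inv x) * \<rho> x = 1\<^sub>m n" "\<rho> x * \<rho> (inv x) = 1\<^sub>m n"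
        using r x by (metis inv_closed l_inv, metis inv_closed r_inv)
      then show ?thesis
        unfolding GL_simps using r x by auto
    qed
    then show "representation G n \<rho>"
      using r by (auto simp: representation_def hom_def GL_simps)
  qed
qed

lemma smult_mat_mult_vec:
  fixes v :: "'a::comm_ring_1 vec"
  assumes "A \<in> carrier_mat m n" "v \<in> carrier_vec n"
  shows "(a \<cdot>\<^sub>m A) *\<^sub>v v = a \<cdot>\<^sub>v (A *\<^sub>v v)"
  using assms by (intro eq_vecI) auto

lemma mat_eq_scalarI:
  fixes A :: "'a::comm_ring_1 mat"
  assumes A: "A \<in> carrier_mat n n" and "\<And>v. v \<in> carrier_vec n \<Longrightarrow> A *\<^sub>v v = a \<cdot>\<^sub>v v"
  shows "A = a \<cdot>\<^sub>m 1\<^sub>m n"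
proof (rule eq_matI)
  fix i j assume ij: "i < dim_row (a \<cdot>\<^sub>m 1\<^sub>m n)" "j < dim_col (a \<cdot>\<^sub>m 1\<^sub>m n)"
  then have "A $$ (i, j) = (A *\<^sub>v unit_vec n j) $ i"
    using A by simp
  also have "\<dots> = (a \<cdot>\<^sub>v unit_vec n j) $ i"
    using assms(2) by simp
  finally show "A $$ (i, j) = (a \<cdot>\<^sub>m 1\<^sub>m n) $$ (i, j)"
    using ij by (simp add: unit_vec_def)
qed (use A in auto)

text \<open>Schur's lemma for a central element: over the complex numbers \<open>\<rho> z\<close>
  has an eigenvalue, its eigenspace is nonzero and is invariant because \<open>z\<close> commutes
  with everything, so by irreducibility it is the whole space.\<close>

lemma (in group) irreducible_center_scalar:
  assumes irr: "irreducible_representation G n \<rho>" and z: "z \<in> center G"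
  obtains a where "\<rho> z = a \<cdot>\<^sub>m 1\<^sub>m n"
proof -
  have rep: "0 < n" "\<And>x. x \<in> carrier G \<Longrightarrow> \<rho> x \<in> carrier_mat n n"
      "\<And>x y. x \<in> carrier G \<Longrightarrow> y \<in> carrier G \<Longrightarrow> \<rho> (x \<otimes> y) = \<rho> x * \<rho> y"
    using irr unfolding irreducible_representation_def representation_iff by blast+
  have zG: "z \<in> carrier G"
    using z by (simp add: center_def)
  obtain a where "eigenvalue (\<rho> z) a"
    using spectrum_non_empty[OF rep(2)[OF zG] rep(1)] by (auto simp: spectrum_def)
  then obtain v where v: "v \<in> carrier_vec n" "v \<noteq> 0\<^sub>v n" "\<rho> z *\<^sub>v v = a \<cdot>\<^sub>v v"
    using rep(2)[OF zG] by (auto simp: eigenvalue_def eigenvector_def)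
  define W where "W = {w \<in> carrier_vec n. \<rho> z *\<^sub>v w = a \<cdot>\<^sub>v w}"
  have "VectorSpace.subspace class_ring W (module_vec TYPE(complex) n)"
    unfolding subspace_vec_iff W_def using rep(2)[OF zG]
    by (auto simp: mult_add_distrib_mat_vec[of _ n n] smult_add_distrib_vec mult_mat_vec[of _ n n]
        smult_smult_assoc mult.commute)
  moreover have "\<rho> g *\<^sub>v w \<in> W" if g: "g \<in> carrier G" and w: "w \<in> W" for g w
  proof -
    have w': "w \<in> carrier_vec n" "\<rho> z *\<^sub>v w = a \<cdot>\<^sub>v w"
      using w by (auto simp: W_def)
    have "\<rho> z *\<^sub>v (\<rho> g *\<^sub>v w) = \<rho> (z \<otimes> g) *\<^sub>v w"
      using rep(2)[OF g] rep(2)[OF zG] rep(3)[OF zG g] w' by simp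
    also have "z \<otimes> g = g \<otimes> z"
      using z g by (simp add: center_def)
    also have "\<rho> (g \<otimes> z) *\<^sub>v w = \<rho> g *\<^sub>v (a \<cdot>\<^sub>v w)"
      using rep(2)[OF g] rep(2)[OF zG] rep(3)[OF g zG] w' by simp
    also have "\<dots> = a \<cdot>\<^sub>v (\<rho> g *\<^sub>v w)"
      using rep(2)[OF g] w' by (simp add: mult_mat_vec)
    finally show ?thesis
      using rep(2)[OF g] w' by (simp add: W_def)
  qed
  moreover have "W \<noteq> {0\<^sub>v n}"
    using v by (auto simp: W_def)
  ultimately have "W = carrier_vec n"
    using irr unfolding irreducible_representation_def by blast
  then have "\<rho> z = a \<cdot>\<^sub>m 1\<^sub>m n"
    using rep(2)[OF zG] by (intro mat_eq_scalarI) (auto simp: W_def)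
  then show thesis by (rule that)
qed

section \<open>Traces and idempotent matrices\<close>

lemma mat_trace_mult_commute:
  fixes A B :: "'a::comm_ring_1 mat"
  assumes A: "A \<in> carrier_mat n m" and B: "B \<in> carrier_mat m n"
  shows "mat_trace (A * B) = mat_trace (B * A)"
proof -
  have "mat_trace (A * B) = (\<Sum>i<n. \<Sum>j<m. A $$ (i, j) * B $$ (j, i))"
    using A B by (simp add: mat_trace_def scalar_prod_def atLeast0LessThan)
  also have "\<dots> = (\<Sum>j<m. \<Sum>i<n. B $$ (j, i) * A $$ (i, j))"
    by (subst sum.swap) (simp add: mult.commute)
  also have "\<dots> = mat_trace (B * A)"
    using A B by (simp add: mat_trace_def scalar_prod_def atLeast0LessThan)
  finally show ?thesis .
qed

text \<open>Induction on the distance \<open>j - i\<close> from the diagonal. In the sum for entry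
  \<open>(i, j)\<close> of \<open>T * T\<close>, a term with \<open>i < k < j\<close> vanishes
  because \<open>T $$ (i, k)\<close> is closer to the diagonal; every other term has a factor on or
  below the diagonal.\<close>

lemma strictly_upper_triangular_idempotent_zero:
  fixes T :: "'a::semiring_0 mat"
  assumes T: "T \<in> carrier_mat n n" and idem: "T * T = T"
    and strict: "\<And>i j. j \<le> i \<Longrightarrow> i < n \<Longrightarrow> T $$ (i, j) = 0"
  shows "T = 0\<^sub>m n n"
proof -
  have "T $$ (i, j) = 0" if "i < n" "j < n" for i j
    using that
  proof (induction "j - i" arbitrary: i j rule: less_induct)
    case less
    have "T $$ (i, j) = (T * T) $$ (i, j)"
      by (simp add: idem)
    also have "\<dots> = (\<Sum>k<n. T $$ (i, k) * T $$ (k, j))"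
      using T less.prems by (simp add: scalar_prod_def atLeast0LessThan)
    also have "\<dots> = 0"
    proof (intro sum.neutral ballI)
      fix k assume k: "k \<in> {..<n}"
      show "T $$ (i, k) * T $$ (k, j) = 0"
      proof (cases "i < k \<and> k < j")
        case True
        then have "k - i < j - i" by (simp add: diff_less_mono)
        then show ?thesis using less.hyps[of k i] less.prems k by simp
      next
        case False
        then show ?thesis using strict[of k i] strict[of j k] less.prems k by auto
      qed
    qed
    finally show ?case .
  qed
  then show ?thesis using T by (intro eq_matI) auto
qed

text \<open>After triangularisation the diagonal entries are idempotent numbers, hence 0 or 1. Their
  sum is 0, so all of them vanish, and the matrix is strictly triangular as well as
  idempotent.\<close>

lemma idempotent_trace_zero:
  fixes Q :: "complex mat"
  assumes Q: "Q \<in> carrier_mat n n" and idem: "Q * Q = Q" and tr: "mat_trace Q = 0"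
  shows "Q = 0\<^sub>m n n"
proof -
  obtain as where "char_poly Q = (\<Prod>a\<leftarrow>as. [:- a, 1:])"
    using char_poly_factorized[OF Q] by blast
  then obtain T where T: "T \<in> carrier_mat n n" "upper_triangular T" "similar_mat Q T"
    using schur_decomposition_exists[OF Q] by blast
  then obtain P P' where "similar_mat_wit Q T P P'"
    unfolding similar_mat_def by blast
  from similar_mat_witD2[OF Q this]
  have P: "P \<in> carrier_mat n n" "P' \<in> carrier_mat n n" "P' * P = 1\<^sub>m n" "Q = P * T * P'"
    and PP': "P * P' = 1\<^sub>m n"
    by auto
  have TQ: "T = P' * Q * P"
  proof -
    have "P' * (P * T) = T"
      using T(1) P(1-3) by (simp flip: assoc_mult_mat[of _ n n _ n _ n])
    then show ?thesis
      using T(1) P by (simp add: assoc_mult_mat[of _ n n _ n _ n])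
  qed
  have "P' * Q * P * (P' * Q * P) = P' * Q * (P * P') * Q * P"
    using P Q by (simp add: assoc_mult_mat[of _ n n _ n _ n])
  moreover have "P' * Q * 1\<^sub>m n * Q * P = P' * (Q * Q) * P"
    using P Q by (simp add: assoc_mult_mat[of _ n n _ n _ n])
  ultimately have idemT: "T * T = T"
    by (simp add: TQ idem PP')
  have T_eq: "T $$ (i, i) * T $$ (i, i) = T $$ (i, i)" if i: "i < n" for i
  proof -
    have "T $$ (i, i) = (\<Sum>k<n. T $$ (i, k) * T $$ (k, i))"
      using T(1) i by (subst idemT[symmetric]) (simp add: scalar_prod_def atLeast0LessThan)
    also have "\<dots> = (\<Sum>k<n. if k = i then T $$ (i, i) * T $$ (i, i) else 0)"
    proof (intro sum.cong refl)
      fix k assume "k \<in> {..<n}"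
      then show "T $$ (i, k) * T $$ (k, i) = (if k = i then T $$ (i, i) * T $$ (i, i) else 0)"
        using T i upper_triangularD[OF T(2), of k i] upper_triangularD[OF T(2), of i k]
        by (cases "k < i"; cases "i < k") auto
    qed
    finally show ?thesis using i by simp
  qed
  have "mat_trace T = mat_trace (P * (P' * Q))"
    unfolding TQ using P Q by (intro mat_trace_mult_commute) auto
  also have "P * (P' * Q) = Q"
    using P Q PP' by (simp flip: assoc_mult_mat[of _ n n _ n _ n])
  \<comment> \<open>Passing to real parts turns the trace condition into a vanishing sum of
    nonnegative reals.\<close>
  finally have "(\<Sum>i<n. Re (T $$ (i, i))) = 0"
    using T tr by (simp add: mat_trace_def flip: Re_sum)
  moreover have nonneg: "0 \<le> Re (T $$ (i, i))" "Re (T $$ (i, i)) = 0 \<Longrightarrow> T $$ (i, i) = 0" if "i < n" for i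
    using T_eq[OF that] by auto
  ultimately have diag: "T $$ (i, i) = 0" if "i < n" for i
    using that sum_nonneg_eq_0_iff[of "{..<n}" "\<lambda>i. Re (T $$ (i, i))"] nonneg by simp
  have "T = 0\<^sub>m n n"
  proof (rule strictly_upper_triangular_idempotent_zero[OF T(1) idemT])
    show "T $$ (i, j) = 0" if "j \<le> i" "i < n" for i j
      using that diag upper_triangularD[OF T(2), of j i] T(1) by (cases "j = i") auto
  qed
  then show ?thesis
    using P by simp
qed

text \<open>The average of \<open>a(z)\<^sup>-\<^sup>1 \<sigma>(z)\<close> over the group is idempotent of full trace, hence the identity.\<close>

lemma (in group) representation_scalar_of_trace:
  fixes a :: "'a \<Rightarrow> complex"
  assumes fin: "finite (carrier G)" and rep: "representation G m \<sigma>"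
    and a1: "a \<one> = 1"
    and a_mult: "\<And>x y. x \<in> carrier G \<Longrightarrow> y \<in> carrier G \<Longrightarrow> a (x \<otimes> y) = a x * a y"
    and tr: "\<And>z. z \<in> carrier G \<Longrightarrow> mat_trace (\<sigma> z) = a z * of_nat m"
    and w: "w \<in> carrier G"
  shows "\<sigma> w = a w \<cdot>\<^sub>m 1\<^sub>m m"
proof -
  note rep = rep[unfolded representation_iff]
  have a_cancel: "a x * a (inv x) = 1" if "x \<in> carrier G" for x
    using a_mult[of x "inv x"] a1 that by simp
  define N where "N = (of_nat (card (carrier G)) :: complex)"
  have N: "N \<noteq> 0"
    using fin by (auto simp: N_def)
  \<comment> \<open>\<open>a (inv z)\<close> serves as the inverse of \<open>a z\<close>. The
    average is the projection onto the vectors on which each \<open>\<sigma> z\<close> acts as the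
    scalar \<open>a z\<close>.\<close>
  define P where "P = mat m m (\<lambda>(i, j). (\<Sum>z\<in>carrier G. a (inv z) * \<sigma> z $$ (i, j)) / N)"
  have P: "P \<in> carrier_mat m m"
    by (simp add: P_def)
  have \<sigma>P: "\<sigma> x * P = a x \<cdot>\<^sub>m P" if x: "x \<in> carrier G" for x
  proof (rule eq_matI)
    fix i j assume "i < dim_row (a x \<cdot>\<^sub>m P)" "j < dim_col (a x \<cdot>\<^sub>m P)"
    then have ij: "i < m" "j < m" using P by auto
    have "(\<sigma> x * P) $$ (i, j) = (\<Sum>k<m. \<sigma> x $$ (i, k) * (\<Sum>z\<in>carrier G. a (inv z) * \<sigma> z $$ (k, j)) / N)"
      using ij rep x by (auto simp: P_def scalar_prod_def atLeast0LessThan)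
    also have "\<dots> = (\<Sum>z\<in>carrier G. a (inv z) * (\<Sum>k<m. \<sigma> x $$ (i, k) * \<sigma> z $$ (k, j))) / N"
      by (simp add: sum_distrib_left sum.swap[of _ "{..<m}"] mult_ac flip: sum_divide_distrib)
    also have "\<dots> = (\<Sum>z\<in>carrier G. a (inv z) * \<sigma> (x \<otimes> z) $$ (i, j)) / N"
    proof -
      have "(\<Sum>k<m. \<sigma> x $$ (i, k) * \<sigma> z $$ (k, j)) = \<sigma> (x \<otimes> z) $$ (i, j)" if "z \<in> carrier G" for z
      proof -
        have "\<sigma> x \<in> carrier_mat m m" "\<sigma> z \<in> carrier_mat m m" "\<sigma> (x \<otimes> z) = \<sigma> x * \<sigma> z"
          using rep x that by auto
        then show ?thesis
          using ij by (simp add: scalar_prod_def atLeast0LessThan)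
      qed
      then show ?thesis by simp
    qed
    \<comment> \<open>Pulling out \<open>a x\<close> makes the summand a function of
      \<open>x \<otimes> z\<close> alone, so that translation by \<open>x\<close> can reindex the
      sum.\<close>
    also have "\<dots> = (\<Sum>z\<in>carrier G. a x * (a (inv (x \<otimes> z)) * \<sigma> (x \<otimes> z) $$ (i, j))) / N"
    proof -
      have "a (inv z) = a x * a (inv (x \<otimes> z))" if "z \<in> carrier G" for z
        using that x a_mult[of "inv z" "inv x"] a_cancel[of x] by (simp add: inv_mult_group mult_ac)
      then show ?thesis by (simp add: mult.assoc)
    qed
    also have "\<dots> = a x * (\<Sum>z\<in>carrier G. a (inv (x \<otimes> z)) * \<sigma> (x \<otimes> z) $$ (i, j)) / N"
      by (simp add: sum_distrib_left)
    also have "(\<Sum>z\<in>carrier G. a (inv (x \<otimes> z)) * \<sigma> (x \<otimes> z) $$ (i, j))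
        = (\<Sum>z\<in>carrier G. a (inv z) * \<sigma> z $$ (i, j))"
      using x by (intro sum.reindex_bij_witness[of _ "\<lambda>z. inv x \<otimes> z" "\<lambda>z. x \<otimes> z"])
        (auto simp flip: m_assoc)
    finally show "(\<sigma> x * P) $$ (i, j) = (a x \<cdot>\<^sub>m P) $$ (i, j)"
      using ij by (simp add: P_def)
  qed (use rep x P in auto)
  have "P * P = P"
  proof (rule eq_matI)
    fix i j assume "i < dim_row P" "j < dim_col P"
    then have ij: "i < m" "j < m" using P by auto
    have "(P * P) $$ (i, j) = (\<Sum>k<m. (\<Sum>z\<in>carrier G. a (inv z) * \<sigma> z $$ (i, k)) / N * P $$ (k, j))"
      using ij P by (simp add: P_def scalar_prod_def atLeast0LessThan)
    also have "\<dots> = (\<Sum>z\<in>carrier G. a (inv z) * (\<Sum>k<m. \<sigma> z $$ (i, k) * P $$ (k, j))) / N"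
      by (simp add: sum_distrib_left sum_distrib_right sum.swap[of _ "{..<m}"] mult_ac
          flip: sum_divide_distrib)
    also have "\<dots> = (\<Sum>z\<in>carrier G. P $$ (i, j)) / N"
    proof -
      have "a (inv z) * (\<Sum>k<m. \<sigma> z $$ (i, k) * P $$ (k, j)) = P $$ (i, j)" if z: "z \<in> carrier G" for z
      proof -
        have "\<sigma> z \<in> carrier_mat m m"
          using rep z by blast
        then have "(\<Sum>k<m. \<sigma> z $$ (i, k) * P $$ (k, j)) = (\<sigma> z * P) $$ (i, j)"
          using ij P by (simp add: scalar_prod_def atLeast0LessThan)
        then show ?thesis
          using \<sigma>P[OF z] a_cancel[OF z] ij P by (simp add: mult_ac)
      qed
      then show ?thesis by simp
    qed
    also have "\<dots> = P $$ (i, j)"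
      using N by (simp add: N_def)
    finally show "(P * P) $$ (i, j) = P $$ (i, j)" .
  qed (use P in auto)
  moreover have "mat_trace P = of_nat m"
  proof -
    have "mat_trace P = (\<Sum>z\<in>carrier G. a (inv z) * (\<Sum>i<m. \<sigma> z $$ (i, i))) / N"
      by (simp add: mat_trace_def P_def sum_distrib_left sum.swap[of _ "{..<m}"] flip: sum_divide_distrib)
    also have "\<dots> = (\<Sum>z\<in>carrier G. of_nat m) / N"
    proof -
      have "a (inv z) * (\<Sum>i<m. \<sigma> z $$ (i, i)) = of_nat m" if z: "z \<in> carrier G" for z
      proof -
        have "\<sigma> z \<in> carrier_mat m m"
          using rep z by blast
        then show ?thesis
          using tr[OF z] a_cancel[OF z] by (simp add: mat_trace_def mult_ac)
      qed
      then show ?thesis by simp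
    qed
    finally show ?thesis using N by (simp add: N_def)
  qed
  \<comment> \<open>The trace criterion is applied to the complementary projection, whose trace is
    \<open>m - m = 0\<close>. With \<open>P\<close> the identity, \<open>\<sigma>P\<close> becomes
    the claim.\<close>
  moreover have "(1\<^sub>m m - P) * (1\<^sub>m m - P) = 1\<^sub>m m - P" if "P * P = P"
  proof -
    have "(1\<^sub>m m - P) * (1\<^sub>m m - P) = (1\<^sub>m m - P) * 1\<^sub>m m - (1\<^sub>m m - P) * P"
      using P by (intro mult_minus_distrib_mat[of _ m m]) auto
    also have "(1\<^sub>m m - P) * P = P - P * P"
      using P by (subst minus_mult_distrib_mat[of _ m m]) auto
    also have "(1\<^sub>m m - P) * 1\<^sub>m m = 1\<^sub>m m - P"
      using P by (intro right_mult_one_mat) auto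
    finally show ?thesis
      using P that by (intro eq_matI) auto
  qed
  ultimately have "1\<^sub>m m - P = 0\<^sub>m m m"
    using P by (intro idempotent_trace_zero) (auto simp: mat_trace_def sum_subtractf)
  then have "(1\<^sub>m m - P) $$ (i, j) = 0" if "i < m" "j < m" for i j
    using that by simp
  then have "P = 1\<^sub>m m"
    using P by (intro eq_matI) (auto simp: mat_eq_iff)
  moreover have "\<sigma> w \<in> carrier_mat m m"
    using rep w by blast
  ultimately show ?thesis
    using \<sigma>P[OF w] by simp
qed

section \<open>Induced irreducible characters on the center\<close>

lemma mat_trace_smult_one: "mat_trace (a \<cdot>\<^sub>m 1\<^sub>m n) = a * of_nat n"
  for a :: "'a::comm_ring_1"
  by (simp add: mat_trace_def mult.commute)

lemma mat_trace_smult: "mat_trace (a \<cdot>\<^sub>m A) = a * mat_trace A"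
  if "A \<in> carrier_mat n n" for a :: "'a::comm_ring_1"
  using that by (simp add: mat_trace_def sum_distrib_left)

lemma center_closed: "z \<in> center G \<Longrightarrow> z \<in> carrier G"
  by (simp add: center_def)

lemma center_commute: "z \<in> center G \<Longrightarrow> g \<in> carrier G \<Longrightarrow> z \<otimes>\<^bsub>G\<^esub> g = g \<otimes>\<^bsub>G\<^esub> z"
  by (simp add: center_def)

lemma (in group) center_subgroup: "subgroup (center G) G"
proof (rule subgroupI)
  fix z assume z: "z \<in> center G"
  have "inv z \<otimes> g = g \<otimes> inv z" if g: "g \<in> carrier G" for g
  proof -
    have zG: "z \<in> carrier G" and "z \<otimes> inv g = inv g \<otimes> z"
      using z g center_closed[OF z] center_commute[OF z, of "inv g"] by simp_all
    then have "inv (z \<otimes> inv g) = inv (inv g \<otimes> z)"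
      by simp
    then show ?thesis
      using zG g by (simp add: inv_mult_group)
  qed
  then show "inv z \<in> center G"
    using z by (simp add: center_def)
next
  fix a b assume a: "a \<in> center G" and b: "b \<in> center G"
  have "a \<otimes> b \<otimes> g = g \<otimes> (a \<otimes> b)" if g: "g \<in> carrier G" for g
  proof -
    have ab: "a \<in> carrier G" "b \<in> carrier G" "b \<otimes> g = g \<otimes> b" "a \<otimes> g = g \<otimes> a"
      using a b g by (auto intro: center_closed center_commute)
    have "a \<otimes> b \<otimes> g = a \<otimes> (g \<otimes> b)"
      using ab(1,2) g by (simp add: m_assoc ab(3))
    also have "\<dots> = (a \<otimes> g) \<otimes> b"
      using ab(1,2) g by (simp add: m_assoc)
    finally show ?thesis
      using ab(1,2) g by (simp add: m_assoc ab(4))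
  qed
  moreover have "a \<otimes> b \<in> carrier G"
    using a b by (simp add: center_closed)
  ultimately show "a \<otimes> b \<in> center G"
    unfolding center_def by blast
qed (auto simp: center_def)

lemma (in group) center_normal: "center G \<lhd> G"
proof -
  have "x \<otimes> z \<otimes> inv x \<in> center G" if x: "x \<in> carrier G" and z: "z \<in> center G" for x z
  proof -
    have "z \<in> carrier G" "x \<otimes> z = z \<otimes> x"
      using x z by (auto intro: center_closed center_commute[symmetric])
    then show ?thesis
      using x z by (simp add: m_assoc)
  qed
  then show ?thesis
    using center_subgroup by (simp add: normal_inv_iff)
qed

text \<open>The scalar is read off from the entry \<open>(0, 0)\<close>, which exists because the
  degree is positive. Multiplicativity on the center is multiplication of scalar matrices.\<close>

lemma (in group) central_character:
  assumes irr: "irreducible_representation G n \<rho>"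
  obtains \<omega> :: "'a \<Rightarrow> complex"
  where "\<And>z. z \<in> center G \<Longrightarrow> \<rho> z = \<omega> z \<cdot>\<^sub>m 1\<^sub>m n" and "\<omega> \<one> = 1"
    and "\<And>x y. x \<in> center G \<Longrightarrow> y \<in> center G \<Longrightarrow> \<omega> (x \<otimes> y) = \<omega> x * \<omega> y"
proof
  have rep: "0 < n" "\<rho> \<one> = 1\<^sub>m n"
      "\<And>x y. x \<in> carrier G \<Longrightarrow> y \<in> carrier G \<Longrightarrow> \<rho> (x \<otimes> y) = \<rho> x * \<rho> y"
    using irr unfolding irreducible_representation_def representation_iff by blast+
  show scalar: "\<rho> z = \<rho> z $$ (0, 0) \<cdot>\<^sub>m 1\<^sub>m n" if "z \<in> center G" for z
  proof -
    obtain a where "\<rho> z = a \<cdot>\<^sub>m 1\<^sub>m n"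
      using irreducible_center_scalar[OF irr \<open>z \<in> center G\<close>] .
    then show ?thesis
      using rep(1) by simp
  qed
  show "\<rho> \<one> $$ (0, 0) = 1"
    using rep by simp
  show "\<rho> (x \<otimes> y) $$ (0, 0) = \<rho> x $$ (0, 0) * \<rho> y $$ (0, 0)"
    if "x \<in> center G" "y \<in> center G" for x y
  proof -
    define a b where "a = \<rho> x $$ (0, 0)" and "b = \<rho> y $$ (0, 0)"
    have "x \<in> carrier G" "y \<in> carrier G"
      using that by (auto intro: center_closed)
    then have "\<rho> (x \<otimes> y) = (a \<cdot>\<^sub>m 1\<^sub>m n) * (b \<cdot>\<^sub>m 1\<^sub>m n)"
      using rep(3) scalar[OF that(1)] scalar[OF that(2)] by (simp flip: a_def b_def)
    also have "\<dots> = a \<cdot>\<^sub>m (b \<cdot>\<^sub>m 1\<^sub>m n)"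
      by (simp add: mult_smult_assoc_mat[of _ n n _ n])
    finally show ?thesis
      using rep(1) by (simp flip: a_def b_def)
  qed
qed

text \<open>Conjugation fixes \<open>z\<close>, so all summands of the induction formula
  coincide.\<close>

lemma (in group) induced_center:
  assumes z: "z \<in> center G"
  shows "induced G U \<psi> z = of_nat (card (carrier G)) / of_nat (card U) * (if z \<in> U then \<psi> z else 0)"
proof -
  have zG: "z \<in> carrier G"
    using z by (rule center_closed)
  have "x \<otimes> z \<otimes> inv x = z" if x: "x \<in> carrier G" for x
  proof -
    have "x \<otimes> z = z \<otimes> x"
      using center_commute[OF z x] by simp
    then show ?thesis
      using x zG by (simp add: m_assoc)
  qed
  then show ?thesis
    using zG by (simp add: induced_def)
qed

text \<open>The character of \<open>\<rho>\<close> has the nonzero value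
  \<open>\<omega> z * n\<close> at a central \<open>z\<close>, whereas an induced character vanishes
  at central elements outside \<open>U\<close>. Inside \<open>U\<close>, comparison with the degrees
  shows that \<open>\<sigma> z\<close> has trace \<open>\<omega> z * m\<close>, and
  \<open>representation_scalar_of_trace\<close>, applied to the group \<open>center G\<close>, makes
  it scalar.\<close>

lemma (in group) induced_irreducible_center:
  fixes \<omega> :: "'a \<Rightarrow> complex"
  assumes fin: "finite (carrier G)" and rep: "representation G n \<rho>"
    and U: "subgroup U G" and \<sigma>: "representation (G\<lparr>carrier := U\<rparr>) m \<sigma>"
    and ind: "char_of G \<rho> = induced G U (char_of (G\<lparr>carrier := U\<rparr>) \<sigma>)"
    and \<omega>: "\<And>z. z \<in> center G \<Longrightarrow> \<rho> z = \<omega> z \<cdot>\<^sub>m 1\<^sub>m n" "\<omega> \<one> = 1"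
      "\<And>x y. x \<in> center G \<Longrightarrow> y \<in> center G \<Longrightarrow> \<omega> (x \<otimes> y) = \<omega> x * \<omega> y"
  shows "center G \<subseteq> U" and "\<And>z. z \<in> center G \<Longrightarrow> \<sigma> z = \<omega> z \<cdot>\<^sub>m 1\<^sub>m m"
proof -
  interpret U: subgroup U G by (rule U)
  interpret GU: group "G\<lparr>carrier := U\<rparr>" by (rule subgroup_imp_group[OF U])
  interpret Z: subgroup "center G" G by (rule center_subgroup)
  interpret GZ: group "G\<lparr>carrier := center G\<rparr>" by (rule subgroup_imp_group[OF center_subgroup])
  note \<sigma> = \<sigma>[unfolded GU.representation_iff, simplified]
  define c where "c = (of_nat (card (carrier G)) / of_nat (card U) :: complex)"
  have n: "0 < n"
    using rep by (simp add: representation_def)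
  have val: "\<omega> z * of_nat n = c * (if z \<in> U then mat_trace (\<sigma> z) else 0)" if z: "z \<in> center G" for z
  proof -
    have "char_of G \<rho> z = \<omega> z * of_nat n"
      using z \<omega>(1)[OF z] by (simp add: char_of_def mat_trace_smult_one)
    then show ?thesis
      using induced_center[OF z, of U "char_of (G\<lparr>carrier := U\<rparr>) \<sigma>", folded ind c_def]
      by (simp add: char_of_def)
  qed
  \<comment> \<open>Evaluation at \<open>\<one>\<close> gives the degree of an induced character,
    with \<open>c\<close> the index of \<open>U\<close>.\<close>
  have deg: "of_nat n = c * of_nat m"
    using val[of \<one>] \<sigma> by (simp add: \<omega>(2) mat_trace_def)
  have \<omega>_nz: "\<omega> z \<noteq> 0" if "z \<in> center G" for z
    using \<omega>(2) \<omega>(3)[of z "inv z"] that by auto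
  show ZU: "center G \<subseteq> U"
  proof
    fix z assume z: "z \<in> center G"
    show "z \<in> U"
      using val[OF z] \<omega>_nz[OF z] n by (auto split: if_splits)
  qed
  have tr: "mat_trace (\<sigma> z) = \<omega> z * of_nat m" if z: "z \<in> center G" for z
  proof -
    have "c * (\<omega> z * of_nat m) = c * mat_trace (\<sigma> z)"
      using val[OF z] ZU z deg by (auto simp: mult_ac)
    moreover have "c \<noteq> 0"
      using deg n by auto
    ultimately show ?thesis by simp
  qed
  have "representation (G\<lparr>carrier := center G\<rparr>) m \<sigma>"
    unfolding GZ.representation_iff using \<sigma> ZU by auto
  moreover have "finite (center G)"
    using fin by (rule finite_subset[rotated]) (rule Z.subset)
  ultimately show "\<sigma> z = \<omega> z \<cdot>\<^sub>m 1\<^sub>m m" if "z \<in> center G" for z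
    using GZ.representation_scalar_of_trace[of m \<sigma> \<omega> z] \<omega> tr that by simp
qed

section \<open>Transfer along a fibre product\<close>

text \<open>\<open>R\<close> is the fibre product in relational form: a subgroup of the direct
  product that projects onto both factors. \<open>kernel_central\<close> ensures that the kernel of
  the projection to \<open>H\<close> acts by scalars in irreducible representations of
  \<open>G\<close>.\<close>

locale group_correspondence = G: group G + H: group H
  for G :: "('a, 'm) monoid_scheme" (structure) and H :: "('b, 'n) monoid_scheme" +
  fixes R :: "'a \<Rightarrow> 'b \<Rightarrow> bool"
  assumes fin: "finite (carrier G)" "finite (carrier H)"
    and R_carrier: "R x y \<Longrightarrow> x \<in> carrier G \<and> y \<in> carrier H"
    and R_mult: "R x y \<Longrightarrow> R x' y' \<Longrightarrow> R (x \<otimes> x') (y \<otimes>\<^bsub>H\<^esub> y')"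
    and R_inv: "R x y \<Longrightarrow> R (inv x) (inv\<^bsub>H\<^esub> y)"
    and left_total: "x \<in> carrier G \<Longrightarrow> \<exists>y. R x y"
    and right_total: "y \<in> carrier H \<Longrightarrow> \<exists>x. R x y"
    and kernel_central: "R z \<one>\<^bsub>H\<^esub> \<Longrightarrow> z \<in> center G"
begin

lemma R_closed [dest]: "R x y \<Longrightarrow> x \<in> carrier G" "R x y \<Longrightarrow> y \<in> carrier H"
  using R_carrier by auto

lemma R_diff_left:
  assumes "R x y" "R x' y"
  shows "R (x \<otimes> inv x') \<one>\<^bsub>H\<^esub>"
  using R_mult[OF assms(1) R_inv[OF assms(2)]] R_closed(2)[OF assms(1)] by simp

lemma R_diff_right:
  assumes "R x y" "R x y'"
  shows "R \<one> (y \<otimes>\<^bsub>H\<^esub> inv\<^bsub>H\<^esub> y')"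
  using R_mult[OF assms(1) R_inv[OF assms(2)]] R_closed(1)[OF assms(1)] by simp

lemma R_one: "R \<one> \<one>\<^bsub>H\<^esub>"
proof -
  obtain y where "R \<one> y"
    using left_total by blast
  from R_diff_left[OF this this] show ?thesis
    by simp
qed

text \<open>Double counting of the related pairs. The fibres of each projection are translates of
  its kernel, so their size is constant along that projection.\<close>

lemma sum_correspondence:
  fixes f :: "'a \<Rightarrow> complex"
  assumes "\<And>x y. R x y \<Longrightarrow> f x = f' y"
  shows "(\<Sum>x\<in>carrier G. f x) * of_nat (card {y. R \<one> y}) =
    (\<Sum>y\<in>carrier H. f' y) * of_nat (card {x. R x \<one>\<^bsub>H\<^esub>})"
proof -
  have card_left: "card {y. R x y} = card {y. R \<one> y}" if x: "x \<in> carrier G" for x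
  proof -
    obtain y0 where y0: "R x y0"
      using left_total[OF x] by blast
    have "bij_betw (\<lambda>y. y \<otimes>\<^bsub>H\<^esub> inv\<^bsub>H\<^esub> y0) {y. R x y} {y. R \<one> y}"
    proof (intro bij_betw_byWitness[where f' = "\<lambda>y. y \<otimes>\<^bsub>H\<^esub> y0"])
      show "\<forall>y\<in>{y. R x y}. y \<otimes>\<^bsub>H\<^esub> inv\<^bsub>H\<^esub> y0 \<otimes>\<^bsub>H\<^esub> y0 = y"
        "\<forall>y\<in>{y. R \<one> y}. y \<otimes>\<^bsub>H\<^esub> y0 \<otimes>\<^bsub>H\<^esub> inv\<^bsub>H\<^esub> y0 = y"
        using R_closed(2) y0 by (auto simp: H.m_assoc)
      show "(\<lambda>y. y \<otimes>\<^bsub>H\<^esub> inv\<^bsub>H\<^esub> y0) ` {y. R x y} \<subseteq> {y. R \<one> y}"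
        using R_diff_right[OF _ y0] by blast
      show "(\<lambda>y. y \<otimes>\<^bsub>H\<^esub> y0) ` {y. R \<one> y} \<subseteq> {y. R x y}"
        using R_mult[OF _ y0, of \<one>] x by auto
    qed
    then show ?thesis by (rule bij_betw_same_card)
  qed
  have card_right: "card {x. R x y} = card {x. R x \<one>\<^bsub>H\<^esub>}" if y: "y \<in> carrier H" for y
  proof -
    obtain x0 where x0: "R x0 y"
      using right_total[OF y] by blast
    have "bij_betw (\<lambda>x. x \<otimes> inv x0) {x. R x y} {x. R x \<one>\<^bsub>H\<^esub>}"
    proof (intro bij_betw_byWitness[where f' = "\<lambda>x. x \<otimes> x0"])
      show "\<forall>x\<in>{x. R x y}. x \<otimes> inv x0 \<otimes> x0 = x" "\<forall>x\<in>{x. R x \<one>\<^bsub>H\<^esub>}. x \<otimes> x0 \<otimes> inv x0 = x"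
        using R_closed(1) x0 by (auto simp: G.m_assoc)
      show "(\<lambda>x. x \<otimes> inv x0) ` {x. R x y} \<subseteq> {x. R x \<one>\<^bsub>H\<^esub>}"
        using R_diff_left[OF _ x0] by blast
      show "(\<lambda>x. x \<otimes> x0) ` {x. R x \<one>\<^bsub>H\<^esub>} \<subseteq> {x. R x y}"
        using R_mult[OF _ x0, of _ "\<one>\<^bsub>H\<^esub>"] y by auto
    qed
    then show ?thesis by (rule bij_betw_same_card)
  qed
  have left: "{y. R x y} = {y \<in> carrier H. R x y}" for x
    by auto
  have right: "{x. R x y} = {x \<in> carrier G. R x y}" for y
    by auto
  have "(\<Sum>x\<in>carrier G. f x) * of_nat (card {y. R \<one> y}) = (\<Sum>x\<in>carrier G. f x * of_nat (card {y. R x y}))"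
    unfolding sum_distrib_right by (rule sum.cong[OF refl], subst card_left) auto
  also have "\<dots> = (\<Sum>x\<in>carrier G. \<Sum>y\<in>carrier H. if R x y then f x else 0)"
    unfolding left using fin by (simp add: sum.If_cases mult.commute Int_def)
  also have "\<dots> = (\<Sum>y\<in>carrier H. \<Sum>x\<in>carrier G. if R x y then f' y else 0)"
    by (subst sum.swap) (intro sum.cong refl, auto simp: assms)
  also have "\<dots> = (\<Sum>y\<in>carrier H. f' y * of_nat (card {x. R x y}))"
    unfolding right using fin by (simp add: sum.If_cases mult.commute Int_def)
  also have "\<dots> = (\<Sum>y\<in>carrier H. f' y) * of_nat (card {x. R x \<one>\<^bsub>H\<^esub>})"
    unfolding sum_distrib_right by (rule sum.cong[OF refl], subst card_right) auto
  finally show ?thesis .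
qed

definition image_subgroup :: "'a set \<Rightarrow> 'b set" where
  "image_subgroup U = {y. \<exists>x\<in>U. R x y}"

lemma image_subgroup_carrier: "image_subgroup (carrier G) = carrier H"
  using right_total R_closed unfolding image_subgroup_def by blast

lemma subgroup_image_subgroup:
  assumes "subgroup U G"
  shows "subgroup (image_subgroup U) H"
proof -
  interpret U: subgroup U G by (rule assms)
  show ?thesis
  proof (rule H.subgroupI)
    show "image_subgroup U \<noteq> {}"
      using R_one U.one_closed unfolding image_subgroup_def by blast
    show "inv\<^bsub>H\<^esub> y \<in> image_subgroup U" if "y \<in> image_subgroup U" for y
      using that R_inv U.m_inv_closed unfolding image_subgroup_def by blast
    show "y \<otimes>\<^bsub>H\<^esub> y' \<in> image_subgroup U" if "y \<in> image_subgroup U" "y' \<in> image_subgroup U" for y y'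
      using that R_mult U.m_closed unfolding image_subgroup_def by blast
  qed (auto simp: image_subgroup_def)
qed

text \<open>Two partners of the same \<open>y\<close> differ by an element of the kernel, which lies
  in \<open>U\<close>; hence either both or neither belong to \<open>U\<close>.\<close>

lemma mem_image_subgroup_iff:
  assumes U: "subgroup U G" and ker: "\<And>z. R z \<one>\<^bsub>H\<^esub> \<Longrightarrow> z \<in> U" and xy: "R x y"
  shows "y \<in> image_subgroup U \<longleftrightarrow> x \<in> U"
proof
  interpret U: subgroup U G by (rule U)
  assume "y \<in> image_subgroup U"
  then obtain u where u: "u \<in> U" "R u y"
    by (auto simp: image_subgroup_def)
  then have "x \<otimes> inv u \<in> U"
    using ker R_diff_left xy by blast
  then have "x \<otimes> inv u \<otimes> u \<in> U"
    using u by simp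
  then show "x \<in> U"
    using u xy R_closed by (simp add: G.m_assoc)
qed (use xy in \<open>auto simp: image_subgroup_def\<close>)

end

section \<open>Twisting by a linear character of the fibre product\<close>

text \<open>\<open>\<mu>\<close> is a linear character of the fibre product in curried form. By
  \<open>\<mu>_kernel\<close> it cancels \<open>\<omega>\<close> on the kernel of the projection to
  \<open>H\<close>, which makes the twisted matrices functions of the
  \<open>H\<close>-component.\<close>

locale twisted_correspondence = group_correspondence G H R
  for G :: "('a, 'm) monoid_scheme" (structure) and H :: "('b, 'n) monoid_scheme"
    and R :: "'a \<Rightarrow> 'b \<Rightarrow> bool" +
  fixes \<mu> :: "'a \<Rightarrow> 'b \<Rightarrow> complex" and \<omega> :: "'a \<Rightarrow> complex"
  assumes \<mu>_mult: "R x y \<Longrightarrow> R x' y' \<Longrightarrow> \<mu> (x \<otimes> x') (y \<otimes>\<^bsub>H\<^esub> y') = \<mu> x y * \<mu> x' y'"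
    and \<mu>_kernel: "R z \<one>\<^bsub>H\<^esub> \<Longrightarrow> \<mu> z \<one>\<^bsub>H\<^esub> * \<omega> z = 1"
begin

lemma \<mu>_one: "\<mu> \<one> \<one>\<^bsub>H\<^esub> = 1"
proof -
  have "\<mu> \<one> \<one>\<^bsub>H\<^esub> * \<mu> \<one> \<one>\<^bsub>H\<^esub> = \<mu> \<one> \<one>\<^bsub>H\<^esub>"
    using \<mu>_mult[OF R_one R_one] by simp
  moreover have "\<mu> \<one> \<one>\<^bsub>H\<^esub> \<noteq> 0"
    using \<mu>_kernel[OF R_one] by auto
  ultimately show ?thesis by simp
qed

lemma \<mu>_inv:
  assumes "R x y"
  shows "\<mu> x y * \<mu> (inv x) (inv\<^bsub>H\<^esub> y) = 1"
  using \<mu>_mult[OF assms R_inv[OF assms]] \<mu>_one R_closed[OF assms] by simp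

lemma \<mu>_nonzero: "R x y \<Longrightarrow> \<mu> x y \<noteq> 0"
  using \<mu>_inv by fastforce

lemma \<mu>_conj:
  assumes "R x y" "R g h"
  shows "\<mu> (x \<otimes> g \<otimes> inv x) (y \<otimes>\<^bsub>H\<^esub> h \<otimes>\<^bsub>H\<^esub> inv\<^bsub>H\<^esub> y) = \<mu> g h"
  using \<mu>_mult[OF R_mult[OF assms] R_inv[OF assms(1)]] \<mu>_mult[OF assms] \<mu>_inv[OF assms(1)]
  by (simp add: mult_ac)

text \<open>An arbitrary partner of \<open>y\<close> in \<open>U\<close> is chosen;
  \<open>twisted_rep_eq\<close> shows that any other one gives the same matrix when
  \<open>\<sigma>\<close> is the scalar \<open>\<omega>\<close> on the kernel.\<close>

definition twisted_rep :: "'a set \<Rightarrow> ('a \<Rightarrow> complex mat) \<Rightarrow> 'b \<Rightarrow> complex mat" where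
  "twisted_rep U \<sigma> y = (let x = SOME x. x \<in> U \<and> R x y in \<mu> x y \<cdot>\<^sub>m \<sigma> x)"

context
  fixes U m \<sigma>
  assumes U: "subgroup U G" and \<sigma>: "representation (G\<lparr>carrier := U\<rparr>) m \<sigma>"
    and ker: "\<And>z. R z \<one>\<^bsub>H\<^esub> \<Longrightarrow> z \<in> U"
    and scalar: "\<And>z. R z \<one>\<^bsub>H\<^esub> \<Longrightarrow> \<sigma> z = \<omega> z \<cdot>\<^sub>m 1\<^sub>m m"
begin

interpretation U: subgroup U G by (rule U)

interpretation GU: group "G\<lparr>carrier := U\<rparr>" by (rule G.subgroup_imp_group[OF U])

lemma representation_facts:
  "0 < m" "\<sigma> \<one> = 1\<^sub>m m" "x \<in> U \<Longrightarrow> \<sigma> x \<in> carrier_mat m m"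
  "x \<in> U \<Longrightarrow> y \<in> U \<Longrightarrow> \<sigma> (x \<otimes> y) = \<sigma> x * \<sigma> y"
  using \<sigma>[unfolded GU.representation_iff] by simp_all

text \<open>The chosen partner is \<open>z \<otimes> x\<close> with \<open>z\<close> in the kernel.
  This changes \<open>\<mu>\<close> by the factor \<open>\<mu> z\<close> at the identity of
  \<open>H\<close> and \<open>\<sigma>\<close> by \<open>\<omega> z\<close>, and the two factors
  cancel.\<close>

lemma twisted_rep_eq:
  assumes x: "x \<in> U" and xy: "R x y"
  shows "twisted_rep U \<sigma> y = \<mu> x y \<cdot>\<^sub>m \<sigma> x"
proof -
  define x' where "x' = (SOME x. x \<in> U \<and> R x y)"
  have x': "x' \<in> U" "R x' y"
    using someI[of "\<lambda>x. x \<in> U \<and> R x y" x] x xy by (simp_all add: x'_def)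
  define z where "z = x' \<otimes> inv x"
  have z: "R z \<one>\<^bsub>H\<^esub>"
    unfolding z_def using R_diff_left[OF x'(2) xy] .
  have "x' = z \<otimes> x"
    using R_closed(1)[OF xy] R_closed(1)[OF x'(2)] by (simp add: z_def G.m_assoc)
  moreover have "\<mu> (z \<otimes> x) y = \<mu> z \<one>\<^bsub>H\<^esub> * \<mu> x y"
    using \<mu>_mult[OF z xy] R_closed(2)[OF xy] by simp
  moreover have "\<sigma> (z \<otimes> x) = \<omega> z \<cdot>\<^sub>m \<sigma> x"
    using representation_facts(3)[OF x] representation_facts(4)[OF ker[OF z] x] scalar[OF z]
    by (simp add: mult_smult_assoc_mat[of _ m m _ m])
  ultimately have "\<mu> x' y \<cdot>\<^sub>m \<sigma> x' = (\<mu> z \<one>\<^bsub>H\<^esub> * \<omega> z * \<mu> x y) \<cdot>\<^sub>m \<sigma> x"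
    using representation_facts(3)[OF x] by (intro eq_matI) (auto simp: mult_ac)
  then show ?thesis
    using \<mu>_kernel[OF z] by (simp add: twisted_rep_def Let_def flip: x'_def)
qed

lemma representation_twisted_rep:
  "representation (H\<lparr>carrier := image_subgroup U\<rparr>) m (twisted_rep U \<sigma>)"
proof -
  interpret HV: group "H\<lparr>carrier := image_subgroup U\<rparr>"
    by (rule H.subgroup_imp_group[OF subgroup_image_subgroup[OF U]])
  have "twisted_rep U \<sigma> y \<in> carrier_mat m m" if "y \<in> image_subgroup U" for y
  proof -
    obtain x where "x \<in> U" "R x y"
      using \<open>y \<in> image_subgroup U\<close> by (auto simp: image_subgroup_def)
    then show ?thesis
      using representation_facts(3) by (simp add: twisted_rep_eq)
  qed
  moreover have "twisted_rep U \<sigma> \<one>\<^bsub>H\<^esub> = 1\<^sub>m m"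
    using twisted_rep_eq[OF U.one_closed R_one] by (simp add: \<mu>_one representation_facts(2)) (auto intro: eq_matI)
  moreover have "twisted_rep U \<sigma> (y \<otimes>\<^bsub>H\<^esub> y') = twisted_rep U \<sigma> y * twisted_rep U \<sigma> y'"
    if "y \<in> image_subgroup U" "y' \<in> image_subgroup U" for y y'
  proof -
    obtain x x' where x: "x \<in> U" "R x y" and x': "x' \<in> U" "R x' y'"
      using \<open>y \<in> image_subgroup U\<close> \<open>y' \<in> image_subgroup U\<close> by (auto simp: image_subgroup_def)
    have "twisted_rep U \<sigma> (y \<otimes>\<^bsub>H\<^esub> y') = (\<mu> x y * \<mu> x' y') \<cdot>\<^sub>m (\<sigma> x * \<sigma> x')"
      using twisted_rep_eq[OF U.m_closed[OF x(1) x'(1)] R_mult[OF x(2) x'(2)]]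
        \<mu>_mult[OF x(2) x'(2)] representation_facts(4)[OF x(1) x'(1)] by simp
    also have "\<dots> = (\<mu> x y \<cdot>\<^sub>m \<sigma> x) * (\<mu> x' y' \<cdot>\<^sub>m \<sigma> x')"
      using representation_facts(3)[OF x(1)] representation_facts(3)[OF x'(1)]
      by (intro eq_matI) (auto simp: mult_ac)
    finally show ?thesis
      using x x' by (simp add: twisted_rep_eq)
  qed
  ultimately show ?thesis
    unfolding HV.representation_iff using representation_facts(1) by simp
qed

lemma trace_twisted_rep:
  assumes "x \<in> U" "R x y"
  shows "mat_trace (twisted_rep U \<sigma> y) = \<mu> x y * mat_trace (\<sigma> x)"
  using twisted_rep_eq[OF assms] representation_facts(3)[OF assms(1)] by (simp add: mat_trace_smult)

text \<open>For related \<open>x\<close> and \<open>y\<close> the conjugates of \<open>g\<close> and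
  \<open>h\<close> are related too, and \<open>\<mu>\<close> is invariant under conjugation, so the
  summands of the two induction formulas differ by the constant factor \<open>\<mu> g h\<close>.
  \<open>sum_correspondence\<close> compares both the sums and the orders of the subgroups, and the
  kernel sizes cancel.\<close>

lemma induced_transfer:
  assumes gh: "R g h"
  shows "induced H (image_subgroup U) (char_of (H\<lparr>carrier := image_subgroup U\<rparr>) (twisted_rep U \<sigma>)) h
    = \<mu> g h * induced G U (char_of (G\<lparr>carrier := U\<rparr>) \<sigma>) g"
proof -
  let ?V = "image_subgroup U"
  define f where "f x = (if x \<otimes> g \<otimes> inv x \<in> U then mat_trace (\<sigma> (x \<otimes> g \<otimes> inv x)) else 0)" for x
  define f' where "f' y = (if y \<otimes>\<^bsub>H\<^esub> h \<otimes>\<^bsub>H\<^esub> inv\<^bsub>H\<^esub> y \<in> ?V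
    then mat_trace (twisted_rep U \<sigma> (y \<otimes>\<^bsub>H\<^esub> h \<otimes>\<^bsub>H\<^esub> inv\<^bsub>H\<^esub> y)) else 0)" for y
  define a where "a = (of_nat (card {y. R \<one> y}) :: complex)"
  define b where "b = (of_nat (card {x. R x \<one>\<^bsub>H\<^esub>}) :: complex)"
  have "finite {y. R \<one> y}" "finite {x. R x \<one>\<^bsub>H\<^esub>}"
    using fin R_closed by (auto intro: finite_subset)
  then have ab: "a \<noteq> 0" "b \<noteq> 0"
    using R_one by (auto simp: a_def b_def)
  have f: "\<mu> g h * f x = f' y" if xy: "R x y" for x y
  proof -
    have conj: "R (x \<otimes> g \<otimes> inv x) (y \<otimes>\<^bsub>H\<^esub> h \<otimes>\<^bsub>H\<^esub> inv\<^bsub>H\<^esub> y)"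
      by (intro R_mult R_inv xy gh)
    show ?thesis
      using mem_image_subgroup_iff[OF U ker conj] trace_twisted_rep[OF _ conj] \<mu>_conj[OF xy gh]
      by (simp add: f_def f'_def)
  qed
  have sums: "(\<mu> g h * (\<Sum>x\<in>carrier G. f x)) * a = (\<Sum>y\<in>carrier H. f' y) * b"
    unfolding a_def b_def sum_distrib_left by (rule sum_correspondence) (rule f)
  \<comment> \<open>The same double counting, applied to the indicator functions of \<open>U\<close>
    and its image.\<close>
  have cards: "of_nat (card U) * a = of_nat (card ?V) * b"
  proof -
    have "(\<Sum>x\<in>carrier G. if x \<in> U then 1 else 0 :: complex) * a
        = (\<Sum>y\<in>carrier H. if y \<in> ?V then 1 else 0) * b"
      unfolding a_def b_def
      by (rule sum_correspondence) (use mem_image_subgroup_iff[OF U ker] in auto)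
    moreover have "carrier G \<inter> U = U" "carrier H \<inter> ?V = ?V"
      using U.subset subgroup.subset[OF subgroup_image_subgroup[OF U]] by auto
    ultimately show ?thesis
      using fin by (simp add: sum.If_cases Int_def)
  qed
  have "of_nat (card U) \<noteq> (0 :: complex)" "of_nat (card ?V) \<noteq> (0 :: complex)"
  proof -
    have "finite U" "finite ?V"
      using fin U.subset subgroup.subset[OF subgroup_image_subgroup[OF U]] by (auto intro: finite_subset)
    moreover have "\<one>\<^bsub>H\<^esub> \<in> ?V"
      by (rule subgroup.one_closed[OF subgroup_image_subgroup[OF U]])
    ultimately show "of_nat (card U) \<noteq> (0 :: complex)" "of_nat (card ?V) \<noteq> (0 :: complex)"
      using U.one_closed by (auto simp only: of_nat_eq_0_iff card_eq_0_iff)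
  qed
  moreover have "(\<Sum>y\<in>carrier H. f' y) * of_nat (card U) = \<mu> g h * (\<Sum>x\<in>carrier G. f x) * of_nat (card ?V)"
  proof -
    have "((\<Sum>y\<in>carrier H. f' y) * of_nat (card U)) * (a * b) = ((\<Sum>y\<in>carrier H. f' y) * b) * (of_nat (card U) * a)"
      by (simp add: mult_ac)
    also have "\<dots> = (\<mu> g h * (\<Sum>x\<in>carrier G. f x) * a) * (of_nat (card ?V) * b)"
      by (simp only: cards sums)
    also have "\<dots> = (\<mu> g h * (\<Sum>x\<in>carrier G. f x) * of_nat (card ?V)) * (a * b)"
      by (simp add: mult_ac)
    finally show ?thesis
      using ab by simp
  qed
  ultimately have "1 / of_nat (card ?V) * (\<Sum>y\<in>carrier H. f' y) = \<mu> g h * (1 / of_nat (card U) * (\<Sum>x\<in>carrier G. f x))"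
    by (simp add: field_simps)
  moreover have "induced H ?V (char_of (H\<lparr>carrier := ?V\<rparr>) (twisted_rep U \<sigma>)) h = 1 / of_nat (card ?V) * (\<Sum>y\<in>carrier H. f' y)"
    using R_closed(2)[OF gh] by (simp add: induced_def char_of_def f'_def Let_def cong: if_cong)
  moreover have "induced G U (char_of (G\<lparr>carrier := U\<rparr>) \<sigma>) g = 1 / of_nat (card U) * (\<Sum>x\<in>carrier G. f x)"
    using R_closed(1)[OF gh] by (simp add: induced_def char_of_def f_def Let_def cong: if_cong)
  ultimately show ?thesis
    by simp
qed

end

lemma proper_image_subgroup:
  assumes U: "proper_subgroup U G" and ker: "\<And>z. R z \<one>\<^bsub>H\<^esub> \<Longrightarrow> z \<in> U"
  shows "proper_subgroup (image_subgroup U) H"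
proof -
  have sub: "subgroup U G" "U \<noteq> carrier G"
    using U by (auto simp: proper_subgroup_def)
  obtain x where x: "x \<in> carrier G" "x \<notin> U"
    using sub subgroup.subset[OF sub(1)] by blast
  obtain y where y: "R x y"
    using left_total[OF x(1)] by blast
  have "y \<notin> image_subgroup U" "y \<in> carrier H"
    using mem_image_subgroup_iff[OF sub(1) ker y] x R_closed(2)[OF y] by auto
  then show ?thesis
    using subgroup_image_subgroup[OF sub(1)] by (auto simp: proper_subgroup_def)
qed

text \<open>A subgroup containing the kernel is recovered from its image, since membership of
  \<open>x\<close> can be tested on any partner.\<close>

lemma image_subgroup_inj:
  assumes U: "subgroup U G" "subgroup U' G"
    and ker: "\<And>z. R z \<one>\<^bsub>H\<^esub> \<Longrightarrow> z \<in> U" "\<And>z. R z \<one>\<^bsub>H\<^esub> \<Longrightarrow> z \<in> U'"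
    and eq: "image_subgroup U = image_subgroup U'"
  shows "U = U'"
proof -
  have "x \<in> U \<longleftrightarrow> x \<in> U'" if x: "x \<in> carrier G" for x
  proof -
    obtain y where y: "R x y"
      using left_total[OF x] by blast
    show ?thesis
      using mem_image_subgroup_iff[OF U(1) ker(1) y] mem_image_subgroup_iff[OF U(2) ker(2) y] eq by blast
  qed
  then show ?thesis
    using subgroup.subset[OF U(1)] subgroup.subset[OF U(2)] by blast
qed

text \<open>Each twisted matrix is a nonzero multiple of some \<open>\<rho> g\<close>, and every
  \<open>g\<close> has a partner, so a subspace invariant under the twisted representation is
  invariant under \<open>\<rho>\<close>.\<close>

lemma irreducible_twisted_rep:
  assumes irr: "irreducible_representation G n \<rho>"
    and scalar: "\<And>z. R z \<one>\<^bsub>H\<^esub> \<Longrightarrow> \<rho> z = \<omega> z \<cdot>\<^sub>m 1\<^sub>m n"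
  shows "irreducible_representation H n (twisted_rep (carrier G) \<rho>)"
  unfolding irreducible_representation_def
proof (intro conjI allI impI)
  \<comment> \<open>The whole group is regarded as a subgroup of itself, so that the facts about
    \<open>U\<close> apply with \<open>U = carrier G\<close>.\<close>
  have rep: "representation (G\<lparr>carrier := carrier G\<rparr>) n \<rho>"
    using irr by (simp add: irreducible_representation_def)
  have ker: "z \<in> carrier G" if "R z \<one>\<^bsub>H\<^esub>" for z
    using that by (rule R_closed(1))
  note ctx = G.subgroup_self rep ker scalar
  show "representation H n (twisted_rep (carrier G) \<rho>)"
    using representation_twisted_rep[OF ctx] by (simp add: image_subgroup_carrier)
  fix W
  assume W: "VectorSpace.subspace class_ring W (module_vec TYPE(complex) n) \<and>
    (\<forall>h\<in>carrier H. \<forall>w\<in>W. twisted_rep (carrier G) \<rho> h *\<^sub>v w \<in> W)"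
  have "\<rho> g *\<^sub>v w \<in> W" if g: "g \<in> carrier G" and w: "w \<in> W" for g w
  proof -
    obtain h where h: "R g h"
      using left_total[OF g] by blast
    have \<rho>g: "\<rho> g \<in> carrier_mat n n"
      using representation_facts(3)[OF ctx g] .
    have w': "w \<in> carrier_vec n"
      using W w by (auto simp: subspace_vec_iff)
    have "twisted_rep (carrier G) \<rho> h *\<^sub>v w \<in> W"
      using W w R_closed(2)[OF h] by blast
    then have "\<mu> g h \<cdot>\<^sub>v (\<rho> g *\<^sub>v w) \<in> W"
      using twisted_rep_eq[OF ctx g h] smult_mat_mult_vec[OF \<rho>g w'] by simp
    then have "(1 / \<mu> g h) \<cdot>\<^sub>v (\<mu> g h \<cdot>\<^sub>v (\<rho> g *\<^sub>v w)) \<in> W"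
      using W by (simp only: subspace_vec_iff)
    then show ?thesis
      using \<mu>_nonzero[OF h] by (simp add: smult_smult_assoc)
  qed
  then show "W = {0\<^sub>v n} \<or> W = carrier_vec n"
    using irr W unfolding irreducible_representation_def by blast
qed

text \<open>Both inducing representations are scalar on the kernel, so each is carried over by the
  same twist, compatibly with induction. The image subgroups stay proper and distinct because the
  original ones contain the kernel.\<close>

lemma multiply_induced_transfer:
  assumes irr: "irreducible_representation G n \<rho>"
    and mult: "multiply_induced G (char_of G \<rho>)"
    and \<omega>: "\<And>z. z \<in> center G \<Longrightarrow> \<rho> z = \<omega> z \<cdot>\<^sub>m 1\<^sub>m n" "\<omega> \<one> = 1"
      "\<And>x y. x \<in> center G \<Longrightarrow> y \<in> center G \<Longrightarrow> \<omega> (x \<otimes> y) = \<omega> x * \<omega> y"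
  shows "multiply_induced H (char_of H (twisted_rep (carrier G) \<rho>))"
proof -
  let ?\<chi> = "char_of H (twisted_rep (carrier G) \<rho>)"
  have rep: "representation (G\<lparr>carrier := carrier G\<rparr>) n \<rho>" "representation G n \<rho>"
    using irr by (simp_all add: irreducible_representation_def)
  have kerG: "z \<in> carrier G" if "R z \<one>\<^bsub>H\<^esub>" for z
    using that by (rule R_closed(1))
  note ctx = G.subgroup_self rep(1) kerG \<omega>(1)[OF kernel_central]
  have \<chi>: "?\<chi> h = \<mu> g h * char_of G \<rho> g" if "R g h" for g h
    using trace_twisted_rep[OF ctx _ that] R_closed[OF that] by (simp add: char_of_def)
  have transfer_induced: "center G \<subseteq> U \<and> is_character (H\<lparr>carrier := image_subgroup U\<rparr>) \<psi>' \<and>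
      ?\<chi> = induced H (image_subgroup U) \<psi>'"
    if U: "proper_subgroup U G" and \<sigma>: "representation (G\<lparr>carrier := U\<rparr>) m \<sigma>"
      and ind: "char_of G \<rho> = induced G U (char_of (G\<lparr>carrier := U\<rparr>) \<sigma>)"
      and \<psi>': "\<psi>' = char_of (H\<lparr>carrier := image_subgroup U\<rparr>) (twisted_rep U \<sigma>)" for U m \<sigma> \<psi>'
  proof -
    have sub: "subgroup U G"
      using U by (simp add: proper_subgroup_def)
    note center = G.induced_irreducible_center[OF fin(1) rep(2) sub \<sigma> ind \<omega>]
    have ker: "z \<in> U" if "R z \<one>\<^bsub>H\<^esub>" for z
      using kernel_central[OF that] center(1) by blast
    have scalar: "\<sigma> z = \<omega> z \<cdot>\<^sub>m 1\<^sub>m m" if "R z \<one>\<^bsub>H\<^esub>" for z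
      using center(2) kernel_central[OF that] by blast
    note ctxU = sub \<sigma> ker scalar
    have "?\<chi> h = induced H (image_subgroup U) \<psi>' h" for h
    proof (cases "h \<in> carrier H")
      case True
      then obtain g where gh: "R g h"
        using right_total by blast
      show ?thesis
        unfolding \<chi>[OF gh] \<psi>' ind by (rule induced_transfer[OF ctxU gh, symmetric])
    next
      \<comment> \<open>Outside \<open>carrier H\<close> both functions are
        \<open>undefined\<close>.\<close>
      case False
      then show ?thesis
        by (simp add: char_of_def induced_def)
    qed
    then show ?thesis
      using center(1) representation_twisted_rep[OF ctxU] unfolding is_character_def \<psi>' by blast
  qed
  obtain U\<^sub>1 U\<^sub>2 m\<^sub>1 m\<^sub>2 \<sigma>\<^sub>1 \<sigma>\<^sub>2 where U: "proper_subgroup U\<^sub>1 G" "proper_subgroup U\<^sub>2 G" "U\<^sub>1 \<noteq> U\<^sub>2"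
    and \<sigma>: "representation (G\<lparr>carrier := U\<^sub>1\<rparr>) m\<^sub>1 \<sigma>\<^sub>1" "representation (G\<lparr>carrier := U\<^sub>2\<rparr>) m\<^sub>2 \<sigma>\<^sub>2"
    and ind: "char_of G \<rho> = induced G U\<^sub>1 (char_of (G\<lparr>carrier := U\<^sub>1\<rparr>) \<sigma>\<^sub>1)"
      "char_of G \<rho> = induced G U\<^sub>2 (char_of (G\<lparr>carrier := U\<^sub>2\<rparr>) \<sigma>\<^sub>2)"
    using mult unfolding multiply_induced_def is_character_def by metis
  note T = transfer_induced[OF U(1) \<sigma>(1) ind(1) refl] transfer_induced[OF U(2) \<sigma>(2) ind(2) refl]
  have ker: "R z \<one>\<^bsub>H\<^esub> \<Longrightarrow> z \<in> U\<^sub>1" "R z \<one>\<^bsub>H\<^esub> \<Longrightarrow> z \<in> U\<^sub>2" for z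
    using T kernel_central by blast+
  have "image_subgroup U\<^sub>1 \<noteq> image_subgroup U\<^sub>2"
    using image_subgroup_inj[OF _ _ ker] U by (auto simp: proper_subgroup_def)
  moreover have "is_character H ?\<chi>"
    using irreducible_twisted_rep[OF irr \<omega>(1)[OF kernel_central]]
    unfolding is_character_def irreducible_representation_def by blast
  ultimately show ?thesis
    unfolding multiply_induced_def
    using T proper_image_subgroup[OF U(1) ker(1)] proper_image_subgroup[OF U(2) ker(2)] by blast
qed

end

section \<open>Isoclinic groups\<close>

lemma (in group) commutator_derived:
  assumes "x \<in> carrier G" "y \<in> carrier G"
  shows "commutator G x y \<in> derived G (carrier G)"
  unfolding derived_def using assms by (intro generate.incl) (auto simp: commutator_def)

context group_correspondence
begin

text \<open>
  For isoclinic groups \<open>\<delta>\<close> is the inverse of the isomorphism of the commutator subgroups. A pair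
  \<open>(x, y)\<close> in the fibre product with \<open>y \<in> H'\<close> differs from \<open>(\<delta> y, y)\<close> by an element of
  \<open>Z(G) \<times> 1\<close>, where the linear character is prescribed.
\<close>

lemma exists_twist:
  fixes \<omega> :: "'a \<Rightarrow> complex" and \<delta> :: "'b \<Rightarrow> 'a"
  assumes \<omega>: "\<omega> \<one> = 1" "\<And>x y. x \<in> center G \<Longrightarrow> y \<in> center G \<Longrightarrow> \<omega> (x \<otimes> y) = \<omega> x * \<omega> y"
    and \<delta>: "\<And>y. y \<in> derived H (carrier H) \<Longrightarrow> R (\<delta> y) y"
      "\<And>y y'. y \<in> derived H (carrier H) \<Longrightarrow> y' \<in> derived H (carrier H) \<Longrightarrow>
        \<delta> (y \<otimes>\<^bsub>H\<^esub> y') = \<delta> y \<otimes> \<delta> y'"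
      "\<And>x y x' y'. R x y \<Longrightarrow> R x' y' \<Longrightarrow> \<delta> (commutator H y y') = commutator G x x'"
  obtains \<mu> where "twisted_correspondence G H R \<mu> \<omega>"
proof -
  define D where "D = derived H (carrier H)"
  interpret D: subgroup D H
    unfolding D_def by (rule H.derived_is_subgroup) simp
  note \<delta> = \<delta>[folded D_def]
  have \<delta>_closed: "\<delta> y \<in> carrier G" if "y \<in> D" for y
    using \<delta>(1)[OF that] by (rule R_closed(1))
  have \<delta>_one: "\<delta> \<one>\<^bsub>H\<^esub> = \<one>"
    using \<delta>(2)[of "\<one>\<^bsub>H\<^esub>" "\<one>\<^bsub>H\<^esub>"] \<delta>_closed[of "\<one>\<^bsub>H\<^esub>"] by (simp add: G.l_cancel_one')
  define K where "K = (G \<times>\<times> H)\<lparr>carrier := {p. R (fst p) (snd p)}\<rparr>"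
  \<comment> \<open>\<open>A\<close> is generated by the kernel of the projection to
    \<open>H\<close> and the graph of \<open>\<delta>\<close>. The function \<open>f\<close> is the
    inverse of \<open>\<omega>\<close> on the kernel component and ignores the graph
    component.\<close>
  define A where "A = {p. R (fst p) (snd p) \<and> snd p \<in> D}"
  define f where "f p = inverse (\<omega> (fst p \<otimes> inv (\<delta> (snd p))))" for p
  interpret GH: group "G \<times>\<times> H"
    by (rule DirProd_group[OF G.is_group H.is_group])
  have K: "subgroup {p. R (fst p) (snd p)} (G \<times>\<times> H)"
  proof (rule GH.subgroupI)
    show "{p. R (fst p) (snd p)} \<subseteq> carrier (G \<times>\<times> H)"
      using R_closed by auto
    show "{p. R (fst p) (snd p)} \<noteq> {}"
      using R_one by auto
    show "inv\<^bsub>G \<times>\<times> H\<^esub> p \<in> {p. R (fst p) (snd p)}" if "p \<in> {p. R (fst p) (snd p)}" for p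
      using that R_inv[of "fst p" "snd p"] R_closed[of "fst p" "snd p"]
        inv_DirProd[OF G.is_group H.is_group, of "fst p" "snd p"] by simp
    show "p \<otimes>\<^bsub>G \<times>\<times> H\<^esub> q \<in> {p. R (fst p) (snd p)}"
      if "p \<in> {p. R (fst p) (snd p)}" "q \<in> {p. R (fst p) (snd p)}" for p q
      using that R_mult by (simp add: mult_DirProd')
  qed
  interpret K: group K
    unfolding K_def by (rule GH.subgroup_imp_group[OF K])
  have K_mult: "p \<otimes>\<^bsub>K\<^esub> q = (fst p \<otimes> fst q, snd p \<otimes>\<^bsub>H\<^esub> snd q)" for p q
    by (simp add: K_def mult_DirProd')
  have K_inv: "inv\<^bsub>K\<^esub> p = (inv (fst p), inv\<^bsub>H\<^esub> (snd p))" if "R (fst p) (snd p)" for p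
    using that GH.m_inv_consistent[OF K, of p] R_closed[OF that]
      inv_DirProd[OF G.is_group H.is_group, of "fst p" "snd p"] by (simp add: K_def)
  have K_carrier: "p \<in> carrier K \<longleftrightarrow> R (fst p) (snd p)" for p
    by (simp add: K_def)
  have K_comm: "commutator K p q = (commutator G (fst p) (fst q), commutator H (snd p) (snd q))"
    if "R (fst p) (snd p)" "R (fst q) (snd q)" for p q
    using that by (simp add: commutator_def K_mult K_inv)
  have "carrier K \<subseteq> carrier G \<times> carrier H"
    using R_closed by (auto simp: K_def)
  then have fin_K: "finite (carrier K)"
    using fin by (auto intro: finite_subset)
  have A: "subgroup A K"
  proof (rule K.subgroupI)
    show "A \<subseteq> carrier K"
      by (auto simp: A_def K_def)
    have "(\<one>, \<one>\<^bsub>H\<^esub>) \<in> A"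
      using R_one by (simp add: A_def)
    then show "A \<noteq> {}" by blast
    show "inv\<^bsub>K\<^esub> p \<in> A" if "p \<in> A" for p
      using that R_inv by (simp add: A_def K_inv)
    show "p \<otimes>\<^bsub>K\<^esub> q \<in> A" if "p \<in> A" "q \<in> A" for p q
      using that R_mult by (simp add: A_def K_mult)
  qed
  \<comment> \<open>By compatibility of \<open>\<delta>\<close> with commutators, every commutator
    of \<open>K\<close> lies on the graph of \<open>\<delta>\<close>, so its kernel component is
    \<open>\<one>\<close>.\<close>
  have comm: "commutator K p q \<in> A" "f (commutator K p q) = 1"
    if "p \<in> carrier K" "q \<in> carrier K" for p q
  proof -
    have pq: "R (fst p) (snd p)" "R (fst q) (snd q)"
      using that by (simp_all add: K_carrier)
    have y: "commutator H (snd p) (snd q) \<in> D"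
      using pq R_closed unfolding D_def by (intro H.commutator_derived) auto
    have "\<delta> (commutator H (snd p) (snd q)) = commutator G (fst p) (fst q)"
      using \<delta>(3)[OF pq] .
    then show "commutator K p q \<in> A" "f (commutator K p q) = 1"
      using y \<delta>(1)[OF y] \<delta>_closed[OF y] by (simp_all add: A_def f_def K_comm[OF pq] \<omega>(1))
  qed
  have z_central: "x \<otimes> inv (\<delta> y) \<in> center G" if "R x y" "y \<in> D" for x y
    using kernel_central[OF R_diff_left[OF that(1) \<delta>(1)[OF that(2)]]] .
  have f_mult: "f (p \<otimes>\<^bsub>K\<^esub> q) = f p * f q" if in_A: "p \<in> A" "q \<in> A" for p q
  proof -
    obtain x y x' y' where pq: "p = (x, y)" "q = (x', y')" "R x y" "y \<in> D" "R x' y'" "y' \<in> D"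
      using in_A by (cases p, cases q) (auto simp: A_def)
    define z' where "z' = x' \<otimes> inv (\<delta> y')"
    note c = R_closed(1)[OF pq(3)] R_closed(1)[OF pq(5)] \<delta>_closed[OF pq(4)] \<delta>_closed[OF pq(6)]
    have z': "z' \<in> center G" "z' \<in> carrier G"
      using z_central[OF pq(5,6)] by (auto simp: z'_def center_closed)
    have "x \<otimes> x' \<otimes> inv (\<delta> (y \<otimes>\<^bsub>H\<^esub> y')) = x \<otimes> (z' \<otimes> inv (\<delta> y))"
      using c pq by (simp add: \<delta>(2) z'_def G.inv_mult_group G.m_assoc)
    \<comment> \<open>Centrality of the kernel component allows the product of the two kernel
      components to be separated, whence multiplicativity of \<open>\<omega>\<close>
      applies.\<close>
    also have "z' \<otimes> inv (\<delta> y) = inv (\<delta> y) \<otimes> z'"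
      using center_commute[OF z'(1), of "inv (\<delta> y)"] c by simp
    also have "x \<otimes> (inv (\<delta> y) \<otimes> z') = (x \<otimes> inv (\<delta> y)) \<otimes> z'"
      using c z'(2) by (simp add: G.m_assoc)
    finally show ?thesis
      using \<omega>(2)[OF z_central[OF pq(3,4)] z'(1)] pq by (simp add: f_def K_mult z'_def)
  qed
  obtain \<mu> :: "'a \<times> 'b \<Rightarrow> complex"
    where \<mu>: "\<forall>p\<in>carrier K. \<forall>q\<in>carrier K. \<mu> (p \<otimes>\<^bsub>K\<^esub> q) = \<mu> p * \<mu> q" "\<forall>p\<in>A. \<mu> p = f p"
    using K.extend_linear_character[OF fin_K A comm f_mult] by auto
  have "twisted_correspondence G H R (\<lambda>x y. \<mu> (x, y)) \<omega>"
  proof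
    fix x y x' y' assume "R x y" "R x' y'"
    then show "\<mu> (x \<otimes> x', y \<otimes>\<^bsub>H\<^esub> y') = \<mu> (x, y) * \<mu> (x', y')"
      using \<mu>(1)[THEN bspec, of "(x, y)", THEN bspec, of "(x', y')"] by (simp add: K_carrier K_mult)
  next
    fix z assume z: "R z \<one>\<^bsub>H\<^esub>"
    have zZ: "z \<in> center G" "inv z \<in> center G" "z \<in> carrier G"
      using kernel_central[OF z] subgroup.m_inv_closed[OF G.center_subgroup] by (auto simp: center_closed)
    have "\<omega> z * \<omega> (inv z) = 1"
      using \<omega>(2)[OF zZ(1,2)] \<omega>(1) zZ(3) by simp
    moreover have "\<mu> (z, \<one>\<^bsub>H\<^esub>) = inverse (\<omega> z)"
      using \<mu>(2)[THEN bspec, of "(z, \<one>\<^bsub>H\<^esub>)"] z zZ(3) by (simp add: A_def f_def \<delta>_one)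
    ultimately show "\<mu> (z, \<one>\<^bsub>H\<^esub>) * \<omega> z = 1"
      by (auto simp: field_simps)
  qed
  then show thesis by (rule that)
qed

end

section \<open>The fibre product of isoclinic groups\<close>

text \<open>\<open>R\<close> relates elements whose cosets modulo the centers match under
  \<open>\<eta>\<close>, and \<open>\<delta>\<close> inverts \<open>\<xi>\<close>. The maps
  \<open>\<eta>\<close> and \<open>\<xi>\<close> are linked only through commutators, so
  \<open>R (\<delta> y) y\<close> is first shown for commutators and then for what they
  generate.\<close>

lemma isoclinic_correspondence:
  fixes G :: "('a, 'm) monoid_scheme" and H :: "('b, 'n) monoid_scheme"
  assumes G: "group G" "finite (carrier G)" and H: "group H" "finite (carrier H)"
    and iso: "isoclinic G H"
  obtains R \<delta> where "group_correspondence G H R"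
    and "\<And>y. y \<in> derived H (carrier H) \<Longrightarrow> R (\<delta> y) y"
    and "\<And>y y'. y \<in> derived H (carrier H) \<Longrightarrow> y' \<in> derived H (carrier H) \<Longrightarrow>
      \<delta> (y \<otimes>\<^bsub>H\<^esub> y') = \<delta> y \<otimes>\<^bsub>G\<^esub> \<delta> y'"
    and "\<And>x y x' y'. R x y \<Longrightarrow> R x' y' \<Longrightarrow> \<delta> (commutator H y y') = commutator G x x'"
proof -
  interpret G: group G by (rule G)
  interpret H: group H by (rule H)
  interpret GZ: normal "center G" G by (rule G.center_normal)
  interpret HZ: normal "center H" H by (rule H.center_normal)
  interpret QG: group "G Mod center G" by (rule GZ.factorgroup_is_group)
  interpret QH: group "H Mod center H" by (rule HZ.factorgroup_is_group)
  obtain \<eta> \<xi> where \<eta>: "\<eta> \<in> iso (G Mod center G) (H Mod center H)"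
    and \<xi>: "\<xi> \<in> iso (commutator_subgroup G) (commutator_subgroup H)"
    and compat: "\<And>g\<^sub>1 g\<^sub>2 h\<^sub>1 h\<^sub>2. g\<^sub>1 \<in> carrier G \<Longrightarrow> g\<^sub>2 \<in> carrier G \<Longrightarrow> h\<^sub>1 \<in> carrier H \<Longrightarrow> h\<^sub>2 \<in> carrier H \<Longrightarrow>
      \<eta> (center G #>\<^bsub>G\<^esub> g\<^sub>1) = center H #>\<^bsub>H\<^esub> h\<^sub>1 \<Longrightarrow> \<eta> (center G #>\<^bsub>G\<^esub> g\<^sub>2) = center H #>\<^bsub>H\<^esub> h\<^sub>2 \<Longrightarrow>
      \<xi> (commutator G g\<^sub>1 g\<^sub>2) = commutator H h\<^sub>1 h\<^sub>2"
    using iso unfolding isoclinic_def by blast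
  \<comment> \<open>Both groups are mapped onto the same quotient of \<open>H\<close>;
    \<open>R\<close> is the fibre product of these two surjections.\<close>
  define a where "a = \<eta> \<circ> (\<lambda>x. center G #>\<^bsub>G\<^esub> x)"
  define b where "b = (\<lambda>y. center H #>\<^bsub>H\<^esub> y)"
  interpret a: group_hom G "H Mod center H" a
  proof
    show "a \<in> hom G (H Mod center H)"
      unfolding a_def by (rule hom_compose[OF GZ.r_coset_hom_Mod iso_imp_homomorphism[OF \<eta>]])
  qed
  interpret b: group_hom H "H Mod center H" b
  proof
    show "b \<in> hom H (H Mod center H)"
      unfolding b_def by (rule HZ.r_coset_hom_Mod)
  qed
  have img: "a ` carrier G = carrier (H Mod center H)" "b ` carrier H = carrier (H Mod center H)"
    using \<eta> by (auto simp: a_def b_def iso_def bij_betw_def carrier_FactGroup image_image)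
  have inj: "inj_on \<eta> (carrier (G Mod center G))"
    using \<eta> by (auto simp: iso_def bij_betw_def)
  define R where "R x y \<longleftrightarrow> x \<in> carrier G \<and> y \<in> carrier H \<and> a x = b y" for x y
  have corr: "group_correspondence G H R"
  proof
    show "finite (carrier G)" "finite (carrier H)" by (fact G H)+
    show "x \<in> carrier G \<and> y \<in> carrier H" if "R x y" for x y
      using that by (simp add: R_def)
    show "R (x \<otimes>\<^bsub>G\<^esub> x') (y \<otimes>\<^bsub>H\<^esub> y')" if "R x y" "R x' y'" for x y x' y'
      using that by (simp add: R_def del: mult_FactGroup)
    show "R (inv\<^bsub>G\<^esub> x) (inv\<^bsub>H\<^esub> y)" if "R x y" for x y
      using that by (simp add: R_def)
    show "\<exists>y. R x y" if x: "x \<in> carrier G" for x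
    proof -
      have "a x \<in> b ` carrier H"
        using img x by auto
      then show ?thesis
        using x by (auto simp: R_def)
    qed
    show "\<exists>x. R x y" if y: "y \<in> carrier H" for y
    proof -
      have "b y \<in> a ` carrier G"
        using img y by auto
      then obtain x where "x \<in> carrier G" "b y = a x"
        by blast
      then show ?thesis
        using y by (auto simp: R_def)
    qed
    show "z \<in> center G" if z: "R z \<one>\<^bsub>H\<^esub>" for z
    proof -
      have zG: "z \<in> carrier G" and "a z = a \<one>\<^bsub>G\<^esub>"
        using z by (auto simp: R_def simp del: one_FactGroup)
      \<comment> \<open>Injectivity of \<open>\<eta>\<close> then forces the coset of
        \<open>z\<close> to be the center itself.\<close>
      then have "\<eta> (center G #>\<^bsub>G\<^esub> z) = \<eta> (center G #>\<^bsub>G\<^esub> \<one>\<^bsub>G\<^esub>)"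
        by (simp add: a_def)
      moreover have "center G #>\<^bsub>G\<^esub> x \<in> carrier (G Mod center G)" if "x \<in> carrier G" for x
        using that by (auto simp: carrier_FactGroup)
      ultimately have "center G #>\<^bsub>G\<^esub> z = center G #>\<^bsub>G\<^esub> \<one>\<^bsub>G\<^esub>"
        using inj zG by (auto dest: inj_onD)
      then have "center G #>\<^bsub>G\<^esub> z = center G"
        using G.coset_mult_one GZ.subset by simp
      then show ?thesis
        using G.rcos_self[OF zG G.center_subgroup] by simp
    qed
  qed
  interpret group_correspondence G H R by (rule corr)
  define D where "D = derived H (carrier H)"
  define \<delta> where "\<delta> = inv_into (derived G (carrier G)) \<xi>"
  have D: "subgroup D H"
    unfolding D_def by (rule H.derived_is_subgroup) simp
  have D': "subgroup (derived G (carrier G)) G"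
    by (rule G.derived_is_subgroup) simp
  interpret D: group "commutator_subgroup H"
    unfolding commutator_subgroup_def by (rule H.subgroup_imp_group[OF D[unfolded D_def]])
  interpret D': group "commutator_subgroup G"
    unfolding commutator_subgroup_def by (rule G.subgroup_imp_group[OF D'])
  have "\<delta> \<in> iso (commutator_subgroup H) (commutator_subgroup G)"
    using D'.iso_set_sym[OF \<xi>] by (simp add: \<delta>_def commutator_subgroup_def)
  then have hom: "\<delta> \<in> hom (commutator_subgroup H) (commutator_subgroup G)"
    by (rule iso_imp_homomorphism)
  have \<delta>_mult: "\<delta> (y \<otimes>\<^bsub>H\<^esub> y') = \<delta> y \<otimes>\<^bsub>G\<^esub> \<delta> y'" if "y \<in> D" "y' \<in> D" for y y'
    using hom_mult[OF hom, of y y'] that by (simp add: commutator_subgroup_def D_def)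
  have \<delta>_one: "\<delta> \<one>\<^bsub>H\<^esub> = \<one>\<^bsub>G\<^esub>"
    using hom_one[OF hom D.is_group D'.is_group] by (simp add: commutator_subgroup_def)
  interpret \<delta>: group_hom "commutator_subgroup H" "commutator_subgroup G" \<delta>
    by unfold_locales (rule hom)
  have \<delta>_inv: "\<delta> (inv\<^bsub>H\<^esub> y) = inv\<^bsub>G\<^esub> (\<delta> y)" if "y \<in> D" for y
  proof -
    have y: "y \<in> carrier (commutator_subgroup H)"
      using that by (simp add: commutator_subgroup_def D_def)
    then have "\<delta> y \<in> derived G (carrier G)"
      using \<delta>.hom_closed[OF y] by (simp add: commutator_subgroup_def)
    then show ?thesis
      using \<delta>.hom_inv[OF y] G.m_inv_consistent[OF D'] H.m_inv_consistent[OF D] that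
      by (simp add: commutator_subgroup_def D_def)
  qed
  have \<delta>_comm: "\<delta> (commutator H y y') = commutator G x x'" if "R x y" "R x' y'" for x y x' y'
  proof -
    have "\<xi> (commutator G x x') = commutator H y y'"
      using that by (intro compat) (auto simp: R_def a_def b_def)
    moreover have "commutator G x x' \<in> derived G (carrier G)"
      using that R_closed by (intro G.commutator_derived) auto
    moreover have "inj_on \<xi> (derived G (carrier G))"
      using \<xi> by (simp add: iso_def bij_betw_def commutator_subgroup_def)
    ultimately show ?thesis
      unfolding \<delta>_def by (metis inv_into_f_f)
  qed
  \<comment> \<open>For a commutator, \<open>\<delta>\<close> yields the commutator of any partners
    of its two entries, and \<open>R\<close> is closed under products and inverses.\<close>
  have \<delta>_derived_set: "R (\<delta> y) y" if "y \<in> derived_set H (carrier H)" for y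
  proof -
    obtain y1 y2 where y: "y1 \<in> carrier H" "y2 \<in> carrier H" "y = commutator H y1 y2"
      using \<open>y \<in> derived_set H (carrier H)\<close> by (auto simp: commutator_def)
    obtain x1 x2 where x: "R x1 y1" "R x2 y2"
      using right_total[OF y(1)] right_total[OF y(2)] by blast
    show ?thesis
      unfolding y(3) \<delta>_comm[OF x] unfolding commutator_def by (intro R_mult R_inv x)
  qed
  have "R (\<delta> y) y" if "y \<in> generate H (derived_set H (carrier H))" for y
    using that
  proof (induction rule: generate.induct)
    case one
    then show ?case using R_one by (simp add: \<delta>_one)
  next
    case (incl h)
    then show ?case by (rule \<delta>_derived_set)
  next
    case (inv h)
    have "h \<in> D"
      unfolding D_def derived_def using inv by (rule generate.incl)
    then show ?case
      using R_inv[OF \<delta>_derived_set[OF inv]] by (simp add: \<delta>_inv)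
  next
    case (eng h1 h2)
    then show ?case
      using R_mult[OF eng.IH] \<delta>_mult[of h1 h2] by (simp add: D_def derived_def)
  qed
  then have "R (\<delta> y) y" if "y \<in> D" for y
    using that by (simp add: D_def derived_def)
  then show thesis
    using that[of R \<delta>] corr \<delta>_mult \<delta>_comm unfolding D_def by blast
qed

theorem theorem1p3:
  fixes G :: "('a, 'm) monoid_scheme" and H :: "('b, 'n) monoid_scheme"
  assumes "group G" and "finite (carrier G)"
    and "group H" and "finite (carrier H)"
    and "isoclinic G H"
    and "\<exists>\<chi>. irreducible_character G \<chi> \<and> multiply_induced G \<chi>"
  shows "\<exists>\<chi>. irreducible_character H \<chi> \<and> multiply_induced H \<chi>"
proof -
  interpret G: group G by fact
  obtain n \<rho> where irr: "irreducible_representation G n \<rho>" and mult: "multiply_induced G (char_of G \<rho>)"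
    using assms(6) unfolding irreducible_character_def by blast
  obtain \<omega> where \<omega>: "\<And>z. z \<in> center G \<Longrightarrow> \<rho> z = \<omega> z \<cdot>\<^sub>m 1\<^sub>m n" "\<omega> \<one>\<^bsub>G\<^esub> = 1"
    "\<And>x y. x \<in> center G \<Longrightarrow> y \<in> center G \<Longrightarrow> \<omega> (x \<otimes>\<^bsub>G\<^esub> y) = \<omega> x * \<omega> y"
    using G.central_character[OF irr] by blast
  show ?thesis
  proof (rule isoclinic_correspondence[OF assms(1-5)])
    fix R \<delta>
    assume "group_correspondence G H R"
      and \<delta>: "\<And>y. y \<in> derived H (carrier H) \<Longrightarrow> R (\<delta> y) y"
        "\<And>y y'. y \<in> derived H (carrier H) \<Longrightarrow> y' \<in> derived H (carrier H) \<Longrightarrow>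
          \<delta> (y \<otimes>\<^bsub>H\<^esub> y') = \<delta> y \<otimes>\<^bsub>G\<^esub> \<delta> y'"
        "\<And>x y x' y'. R x y \<Longrightarrow> R x' y' \<Longrightarrow> \<delta> (commutator H y y') = commutator G x x'"
    then interpret group_correspondence G H R by simp
    \<comment> \<open>The twist is built for the central character of this particular
      \<open>\<rho>\<close>; the resulting twist of \<open>\<rho>\<close> provides the required
      character of \<open>H\<close>.\<close>
    obtain \<mu> where "twisted_correspondence G H R \<mu> \<omega>"
      by (rule exists_twist[OF \<omega>(2,3) \<delta>])
    then interpret twisted_correspondence G H R \<mu> \<omega> .
    have "irreducible_representation H n (twisted_rep (carrier G) \<rho>)"
      using irreducible_twisted_rep[OF irr \<omega>(1)[OF kernel_central]] .
    moreover have "multiply_induced H (char_of H (twisted_rep (carrier G) \<rho>))"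
      using multiply_induced_transfer[OF irr mult \<omega>] .
    ultimately show ?thesis
      unfolding irreducible_character_def by blast
  qed
qed

end
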